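(* Let $L$ and $M$ be purely transcendental extensions of a field $K$ of the same finite transcendence degree, and let $G$ be a subgroup of $Aut(M/K)$. Then $G$ is a Noether solution of $M/K$ if and only if there is a nice basis $(\Delta,A)$ of $L/K$ such that (i) $L$ is Galois over $K(\Delta)$, and (ii) $Aut(L/K(\Delta))$ and $G$ are $(L,M)$-spatially isomorphic.
   Context: $Aut(E/F)$ is the group of automorphisms of $E$ fixing $F$; $E^H$ is the fixed field; $E/F$ is Galois if $E^{Aut(E/F)}=F$. A nice basis of $L/K$ is $(\Delta,A)$ with $\Delta$ a transcendence base of $L/K$ and $A$ a basis of $L$ over $K(\Delta)$. A Noether solution of $M/K$ is a subgroup $G\subseteq Aut(M/K)$ with $M$ algebraic over $M^G$ and $M^G$ purely transcendental over $K$. Subgroups $G_1\subseteq Aut(L/K)$ and $G_2\subseteq Aut(M/K)$ are $(L,M)$-spatially isomorphic if there are a group isomorphism $\psi:G_1\to G_2$ and a $K$-isomorphism $\phi:L\to M$ with $g(x)=\phi^{-1}(\psi(g)(\phi(x)))$ for all $g\in G_1$, $x\in L$, and $g(x)=x$ iff $\psi(g)(\phi(x))=\phi(x)$. *)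

theory Defs
  imports Main "HOL-Computational_Algebra.Polynomial" "HOL-Library.Poly_Mapping" "HOL-Algebra.Group"
begin

text \<open>
  Ambient fields are types of class \<open>field\<close>; subfields and intermediate fields are sets of
  elements. An extension \<open>L/K\<close> is an embedding \<open>i\<close> of the field type of \<open>K\<close> into that of \<open>L\<close>,
  and \<open>K\<close> is then identified with the subfield \<open>range i\<close>.
\<close>

definition field_hom :: "('a::field \<Rightarrow> 'b::field) \<Rightarrow> bool" where
  "field_hom f \<longleftrightarrow>
     f 1 = 1 \<and> (\<forall>x y. f (x + y) = f x + f y) \<and> (\<forall>x y. f (x * y) = f x * f y)"

definition is_subfield :: "'a::field set \<Rightarrow> bool" where
  "is_subfield F \<longleftrightarrow> 0 \<in> F \<and> 1 \<in> F \<and>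
     (\<forall>x\<in>F. \<forall>y\<in>F. x + y \<in> F \<and> x * y \<in> F) \<and> (\<forall>x\<in>F. - x \<in> F \<and> inverse x \<in> F)"

definition adjoin :: "'a::field set \<Rightarrow> 'a set \<Rightarrow> 'a set" where
  "adjoin F S = \<Inter>{E. is_subfield E \<and> F \<union> S \<subseteq> E}"

definition algebraic_over :: "'a::field set \<Rightarrow> 'a \<Rightarrow> bool" where
  "algebraic_over F x \<longleftrightarrow>
     (\<exists>p. p \<noteq> 0 \<and> (\<forall>n. Polynomial.coeff p n \<in> F) \<and> poly p x = 0)"

text \<open>
  In a multivariate polynomial of type \<open>('a \<Rightarrow>\<^sub>0 nat) \<Rightarrow>\<^sub>0 'a\<close> the variables are indexed by the
  elements of the field, and \<open>eval_self\<close> substitutes for each variable the element indexing it.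
\<close>

definition eval_self :: "(('a::field \<Rightarrow>\<^sub>0 nat) \<Rightarrow>\<^sub>0 'a) \<Rightarrow> 'a" where
  "eval_self p =
     (\<Sum>m\<in>Poly_Mapping.keys p.
        Poly_Mapping.lookup p m * (\<Prod>x\<in>Poly_Mapping.keys m. x ^ Poly_Mapping.lookup m x))"

definition alg_independent :: "'a::field set \<Rightarrow> 'a set \<Rightarrow> bool" where
  "alg_independent F S \<longleftrightarrow>
     (\<forall>p. (\<forall>m\<in>Poly_Mapping.keys p.
             Poly_Mapping.lookup p m \<in> F \<and> Poly_Mapping.keys m \<subseteq> S) \<longrightarrow>
          eval_self p = 0 \<longrightarrow> p = 0)"

definition transcendence_base :: "'a::field set \<Rightarrow> 'a set \<Rightarrow> 'a set \<Rightarrow> bool" where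
  "transcendence_base F E B \<longleftrightarrow>
     B \<subseteq> E \<and> alg_independent F B \<and> (\<forall>x\<in>E. algebraic_over (adjoin F B) x)"

definition has_finite_trdeg :: "'a::field set \<Rightarrow> 'a set \<Rightarrow> nat \<Rightarrow> bool" where
  "has_finite_trdeg F E n \<longleftrightarrow> (\<exists>B. transcendence_base F E B \<and> finite B \<and> card B = n)"

definition purely_transcendental :: "'a::field set \<Rightarrow> 'a set \<Rightarrow> bool" where
  "purely_transcendental F E \<longleftrightarrow> (\<exists>S. alg_independent F S \<and> E = adjoin F S)"

definition basis_over :: "'a::field set \<Rightarrow> 'a set \<Rightarrow> bool" where
  "basis_over F A \<longleftrightarrow>
     (\<forall>S c. finite S \<and> S \<subseteq> A \<and> c ` S \<subseteq> F \<and> (\<Sum>a\<in>S. c a * a) = 0 \<longrightarrow> (\<forall>a\<in>S. c a = 0)) \<and>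
     (\<forall>x. \<exists>S c. finite S \<and> S \<subseteq> A \<and> c ` S \<subseteq> F \<and> x = (\<Sum>a\<in>S. c a * a))"

definition nice_basis :: "'a::field set \<Rightarrow> 'a set \<Rightarrow> 'a set \<Rightarrow> bool" where
  "nice_basis F \<Delta> A \<longleftrightarrow> transcendence_base F UNIV \<Delta> \<and> basis_over (adjoin F \<Delta>) A"

definition Aut :: "'a::field set \<Rightarrow> ('a \<Rightarrow> 'a) set" where
  "Aut F = {\<sigma>. field_hom \<sigma> \<and> bij \<sigma> \<and> (\<forall>x\<in>F. \<sigma> x = x)}"

definition Aut_group :: "'a::field set \<Rightarrow> ('a \<Rightarrow> 'a) monoid" where
  "Aut_group F = \<lparr>carrier = Aut F, mult = (\<circ>), one = id\<rparr>"

definition fixed_field :: "('a \<Rightarrow> 'a) set \<Rightarrow> 'a::field set" where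
  "fixed_field H = {x. \<forall>\<sigma>\<in>H. \<sigma> x = x}"

definition galois_over :: "'a::field set \<Rightarrow> bool" where
  "galois_over F \<longleftrightarrow> fixed_field (Aut F) = F"

definition noether_solution :: "'a::field set \<Rightarrow> ('a \<Rightarrow> 'a) set \<Rightarrow> bool" where
  "noether_solution F G \<longleftrightarrow>
     subgroup G (Aut_group F) \<and>
     (\<forall>x. algebraic_over (fixed_field G) x) \<and>
     purely_transcendental F (fixed_field G)"

definition spatially_isomorphic ::
  "('k::field \<Rightarrow> 'l::field) \<Rightarrow> ('k \<Rightarrow> 'm::field) \<Rightarrow> ('l \<Rightarrow> 'l) set \<Rightarrow> ('m \<Rightarrow> 'm) set \<Rightarrow> bool" where
  "spatially_isomorphic i j G1 G2 \<longleftrightarrow>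
     subgroup G1 (Aut_group (range i)) \<and> subgroup G2 (Aut_group (range j)) \<and>
     (\<exists>\<psi> \<phi>. \<psi> \<in> iso ((Aut_group (range i))\<lparr>carrier := G1\<rparr>) ((Aut_group (range j))\<lparr>carrier := G2\<rparr>) \<and>
        field_hom \<phi> \<and> bij \<phi> \<and> (\<forall>k. \<phi> (i k) = j k) \<and>
        (\<forall>g\<in>G1. \<forall>x. g x = the_inv \<phi> (\<psi> g (\<phi> x)) \<and> (g x = x \<longleftrightarrow> \<psi> g (\<phi> x) = \<phi> x)))"

lemma field_hom_comp: "field_hom f \<Longrightarrow> field_hom g \<Longrightarrow> field_hom (f \<circ> g)"
  by (simp add: field_hom_def)

lemma Aut_inv: "\<sigma> \<in> Aut F \<Longrightarrow> inv_into UNIV \<sigma> \<in> Aut F"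
proof -
  assume "\<sigma> \<in> Aut F"
  then have h: "field_hom \<sigma>" "bij \<sigma>" "\<forall>x\<in>F. \<sigma> x = x" by (auto simp: Aut_def)
  let ?t = "inv_into UNIV \<sigma>"
  have s: "\<sigma> (?t x) = x" and t: "?t (\<sigma> x) = x" for x
    using h(2) by (simp_all add: bij_is_surj surj_f_inv_f bij_is_inj)
  have "?t 1 = 1" "?t (x + y) = ?t x + ?t y" "?t (x * y) = ?t x * ?t y" for x y
    using h(1) s t unfolding field_hom_def by metis+
  moreover have "\<forall>x\<in>F. ?t x = x" using h(3) t by metis
  ultimately show ?thesis using h(2) by (simp add: Aut_def field_hom_def bij_imp_bij_inv)
qed

lemma group_Aut_group: "group (Aut_group F)"
proof (rule groupI)
  fix \<sigma> assume "\<sigma> \<in> carrier (Aut_group F)"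
  then have s: "\<sigma> \<in> Aut F" by (simp add: Aut_group_def)
  then have "inv_into UNIV \<sigma> \<circ> \<sigma> = id" by (auto simp: Aut_def bij_is_inj)
  then show "\<exists>\<tau>\<in>carrier (Aut_group F). \<tau> \<otimes>\<^bsub>Aut_group F\<^esub> \<sigma> = \<one>\<^bsub>Aut_group F\<^esub>"
    using Aut_inv[OF s] by (auto simp: Aut_group_def)
qed (auto simp: Aut_group_def Aut_def field_hom_comp bij_comp field_hom_def o_assoc)

lemma is_subfield_adjoin: "is_subfield (adjoin F S)"
  unfolding adjoin_def is_subfield_def by blast

end

theory Submission imports Defs "HOL-Algebra.Algebraic_Closure_Type" begin

text \<open>
  By the exchange property for algebraic dependence, \<open>L\<close> and \<open>M\<close> are generated over \<open>K\<close> by algebraically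
  independent sets of the same finite size, so there is a \<open>K\<close>-isomorphism \<open>\<phi> : L \<rightarrow> M\<close>. If \<open>G\<close> is a
  Noether solution, then \<open>M\<close> is finitely generated and algebraic over \<open>M\<^sup>G\<close>, so \<open>G\<close> is finite and
  \<open>G = Aut(M/M\<^sup>G)\<close> by Artin's theorem. Hence \<open>G\<close> corresponds under \<open>\<phi>\<close> to the automorphism group of \<open>L\<close> over the
  preimage of \<open>M\<^sup>G\<close>, and an algebraically independent generating set of \<open>M\<^sup>G\<close> pulls back to \<open>\<Delta>\<close>.
  Conversely, a spatial isomorphism carries the fixed field \<open>K(\<Delta>)\<close> to \<open>M\<^sup>G\<close>.
\<close>

section \<open>Homomorphisms\<close>

text \<open>Elements of a generated field are fractions, while algebraic independence speaks of
  polynomials. The proof therefore clears denominators and works with formal polynomials over the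
  type of K, whose values can be taken in L, in M or in L[X]; this is how relations pass from one
  ring to another. The definitions supply a transcendence base of size \<open>n\<close> and an
  independent generating set without relating them; only the exchange argument shows that the latter
  has \<open>n\<close> elements too. Artin's theorem serves both conditions: it makes the conjugates
  of Aut(L/K(\<Delta>)) exhaust \<open>G\<close>, and it makes the fixed field of that group no
  larger than K(\<Delta>). In the converse the compatibility clause leaves no freedom:
  \<open>\<psi>\<close> must be conjugation by \<open>\<phi>\<close>.\<close>

definition unital_hom :: "('a::comm_ring_1 \<Rightarrow> 'b::comm_ring_1) \<Rightarrow> bool" where
  "unital_hom f \<longleftrightarrow> f 0 = 0 \<and> f 1 = 1 \<and>
     (\<forall>x y. f (x + y) = f x + f y) \<and> (\<forall>x y. f (x * y) = f x * f y)"

lemma unital_homD: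
  assumes "unital_hom f"
  shows "f 0 = 0" "f 1 = 1" "f (x + y) = f x + f y" "f (x * y) = f x * f y"
  using assms by (auto simp: unital_hom_def)

lemma unital_hom_uminus: "unital_hom f \<Longrightarrow> f (- x) = - f x"
  by (metis add.right_inverse minus_unique unital_homD(1,3))

lemma unital_hom_sum: "unital_hom f \<Longrightarrow> f (sum g A) = (\<Sum>x\<in>A. f (g x))"
  by (induction A rule: infinite_finite_induct) (auto simp: unital_homD)

lemma unital_hom_prod: "unital_hom f \<Longrightarrow> f (prod g A) = (\<Prod>x\<in>A. f (g x))"
  by (induction A rule: infinite_finite_induct) (auto simp: unital_homD)

lemma unital_hom_power: "unital_hom f \<Longrightarrow> f (x ^ n) = f x ^ n"
  by (induction n) (auto simp: unital_homD)

lemma unital_hom_const_poly: "unital_hom (\<lambda>x. [:x:])"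
  by (auto simp: unital_hom_def one_pCons)

lemma unital_hom_comp: "unital_hom f \<Longrightarrow> unital_hom g \<Longrightarrow> unital_hom (\<lambda>x. f (g x))"
  by (auto simp: unital_hom_def)

text \<open>Polynomial rings are the reason for using ring homomorphisms beside
  \<open>field_hom\<close>: \<open>artin_fixed_field\<close> extends an automorphism coefficientwise
  twice, to M[Y] and then to M[Y][X].\<close>

lemma unital_hom_map_poly: "unital_hom f \<Longrightarrow> unital_hom (map_poly f)"
  by (auto simp: unital_hom_def poly_eq_iff coeff_map_poly coeff_mult unital_hom_sum[unfolded unital_hom_def])

lemma poly_map_poly_hom:
  assumes "unital_hom f"
  shows "poly (map_poly f p) (f x) = f (poly p x)"
proof (induction p)
  case 0
  then show ?case using assms by (simp add: unital_homD)
next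
  case (pCons a p)
  then show ?case using assms
    by (simp add: map_poly_pCons unital_homD)
qed

lemma field_hom_unital_hom: "field_hom f \<Longrightarrow> unital_hom f"
proof -
  assume f: "field_hom f"
  then have "f 0 + f 0 = f 0" by (metis add_0 field_hom_def)
  then have "f 0 = 0" by (simp only: add_cancel_left_left)
  then show ?thesis using f by (simp add: field_hom_def unital_hom_def)
qed

lemma field_hom_eq_0_iff: "field_hom f \<Longrightarrow> f x = 0 \<longleftrightarrow> x = 0"
proof (cases "x = 0")
  case True
  assume "field_hom f"
  then show ?thesis using True by (simp add: field_hom_unital_hom unital_homD)
next
  case False
  assume "field_hom f"
  then have "f x * f (inverse x) = 1"
    using False by (metis field_hom_def right_inverse)
  then show ?thesis using False by auto
qed

lemma field_hom_inverse: "field_hom f \<Longrightarrow> f (inverse x) = inverse (f x)"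
proof (cases "x = 0")
  case True
  assume "field_hom f"
  then show ?thesis using True by (simp add: field_hom_unital_hom unital_homD)
next
  case False
  assume "field_hom f"
  then have "f x * f (inverse x) = 1"
    using False by (metis field_hom_def right_inverse)
  then show ?thesis by (metis inverse_unique)
qed

lemma field_hom_inj: "field_hom f \<Longrightarrow> inj f"
proof (rule injI)
  fix x y assume f: "field_hom f" and e: "f x = f y"
  have "f (x + - y) = 0"
    using e by (simp only: unital_homD(3)[OF field_hom_unital_hom[OF f]]
      unital_hom_uminus[OF field_hom_unital_hom[OF f]] right_minus)
  then show "x = y" using f by (simp add: field_hom_eq_0_iff)
qed

lemma field_hom_inv:
  assumes "field_hom f" "bij f"
  shows "field_hom (inv_into UNIV f)"
proof -
  have 1: "\<And>x. inv_into UNIV f (f x) = x" and 2: "\<And>y. f (inv_into UNIV f y) = y"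
    using assms(2) by (simp_all add: bij_is_inj bij_is_surj surj_f_inv_f)
  show ?thesis
    using assms(1) 1 2 unfolding field_hom_def by metis
qed

section \<open>Subfields and adjunction\<close>

lemma is_subfieldD:
  assumes "is_subfield F"
  shows "0 \<in> F" "1 \<in> F" "x \<in> F \<Longrightarrow> y \<in> F \<Longrightarrow> x + y \<in> F" "x \<in> F \<Longrightarrow> y \<in> F \<Longrightarrow> x * y \<in> F"
    "x \<in> F \<Longrightarrow> - x \<in> F" "x \<in> F \<Longrightarrow> inverse x \<in> F"
  using assms by (auto simp: is_subfield_def)

lemma is_subfield_sum: "is_subfield F \<Longrightarrow> (\<And>x. x \<in> A \<Longrightarrow> g x \<in> F) \<Longrightarrow> sum g A \<in> F"
  by (induction A rule: infinite_finite_induct) (auto simp: is_subfieldD)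

lemma is_subfield_power: "is_subfield F \<Longrightarrow> x \<in> F \<Longrightarrow> x ^ n \<in> F"
  by (induction n) (auto simp: is_subfieldD)

lemma is_subfield_UNIV: "is_subfield UNIV"
  by (simp add: is_subfield_def)

lemma is_subfield_image: "field_hom f \<Longrightarrow> is_subfield F \<Longrightarrow> is_subfield (f ` F)"
  unfolding is_subfield_def
  by (auto simp: unital_homD[OF field_hom_unital_hom, symmetric]
      unital_hom_uminus[OF field_hom_unital_hom, symmetric] field_hom_inverse[symmetric])

lemma is_subfield_vimage: "field_hom f \<Longrightarrow> is_subfield F \<Longrightarrow> is_subfield (f -` F)"
  unfolding is_subfield_def
  by (auto simp: unital_homD[OF field_hom_unital_hom]
      unital_hom_uminus[OF field_hom_unital_hom] field_hom_inverse)

lemma is_subfield_range: "field_hom f \<Longrightarrow> is_subfield (range f)"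
  by (simp add: is_subfield_image is_subfield_UNIV)

lemma is_subfield_equalizer:
  assumes "field_hom f" "field_hom g"
  shows "is_subfield {x. f x = g x}"
  unfolding is_subfield_def
  using assms by (auto simp: unital_homD[OF field_hom_unital_hom]
      unital_hom_uminus[OF field_hom_unital_hom] field_hom_inverse)

lemma adjoin_upper: "F \<subseteq> adjoin F S" "S \<subseteq> adjoin F S"
  by (auto simp: adjoin_def)

lemma adjoin_least: "is_subfield E \<Longrightarrow> F \<subseteq> E \<Longrightarrow> S \<subseteq> E \<Longrightarrow> adjoin F S \<subseteq> E"
  by (auto simp: adjoin_def)

lemma adjoin_mono: "F \<subseteq> E \<Longrightarrow> S \<subseteq> T \<Longrightarrow> adjoin F S \<subseteq> adjoin E T"
  by (meson adjoin_least adjoin_upper is_subfield_adjoin subset_trans)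

lemma adjoin_adjoin: "adjoin (adjoin F V) Y = adjoin F (V \<union> Y)"
proof
  show "adjoin (adjoin F V) Y \<subseteq> adjoin F (V \<union> Y)"
    using adjoin_upper[of "V \<union> Y" F] by (intro adjoin_least is_subfield_adjoin adjoin_mono) auto
  show "adjoin F (V \<union> Y) \<subseteq> adjoin (adjoin F V) Y"
    using adjoin_upper[of F V] adjoin_upper[of V F] adjoin_upper[of Y "adjoin F V"] adjoin_upper[of "adjoin F V" Y]
    by (intro adjoin_least is_subfield_adjoin) auto
qed

lemma image_adjoin:
  assumes f: "field_hom f"
  shows "f ` adjoin F S = adjoin (f ` F) (f ` S)"
proof
  have "adjoin F S \<subseteq> f -` adjoin (f ` F) (f ` S)"
    using adjoin_upper[of "f ` F" "f ` S"] adjoin_upper[of "f ` S" "f ` F"]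
    by (intro adjoin_least is_subfield_vimage is_subfield_adjoin f) auto
  then show "f ` adjoin F S \<subseteq> adjoin (f ` F) (f ` S)" by auto
  show "adjoin (f ` F) (f ` S) \<subseteq> f ` adjoin F S"
    by (intro adjoin_least is_subfield_image is_subfield_adjoin f image_mono adjoin_upper)
qed

lemma algebraic_over_mono: "F \<subseteq> F' \<Longrightarrow> algebraic_over F x \<Longrightarrow> algebraic_over F' x"
  unfolding algebraic_over_def by blast

lemma algebraic_over_image:
  assumes f: "field_hom f" and x: "algebraic_over F x"
  shows "algebraic_over (f ` F) (f x)"
proof -
  obtain p where p: "p \<noteq> 0" "\<And>n. Polynomial.coeff p n \<in> F" "poly p x = 0"
    using x by (auto simp: algebraic_over_def)
  note u = field_hom_unital_hom[OF f]
  have "map_poly f p \<noteq> 0"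
    using p(1) f by (simp add: poly_eq_iff coeff_map_poly unital_homD(1)[OF u] field_hom_eq_0_iff)
  moreover have "poly (map_poly f p) (f x) = 0"
    by (simp add: poly_map_poly_hom[OF u] p(3) unital_homD(1)[OF u])
  ultimately show ?thesis
    using p(2) unfolding algebraic_over_def
    by (intro exI[of _ "map_poly f p"]) (auto simp: coeff_map_poly unital_homD(1)[OF u])
qed

section \<open>Fractions and common denominators\<close>

definition subring_set :: "'a::field set \<Rightarrow> bool" where
  "subring_set D \<longleftrightarrow> 1 \<in> D \<and> (\<forall>x\<in>D. \<forall>y\<in>D. x + y \<in> D \<and> x * y \<in> D) \<and> (\<forall>x\<in>D. - x \<in> D)"

lemma is_subfield_fractions:
  assumes "subring_set D"
  shows "is_subfield {a / b |a b. a \<in> D \<and> b \<in> D \<and> b \<noteq> 0}" (is "is_subfield ?Q")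
proof -
  have D: "1 \<in> D" "\<And>x y. x \<in> D \<Longrightarrow> y \<in> D \<Longrightarrow> x + y \<in> D" "\<And>x y. x \<in> D \<Longrightarrow> y \<in> D \<Longrightarrow> x * y \<in> D"
    "\<And>x. x \<in> D \<Longrightarrow> - x \<in> D"
    using assms by (auto simp: subring_set_def)
  have D0: "0 \<in> D" using D(2)[of 1 "-1"] D(1,4) by simp
  have I: "a / b \<in> ?Q" if "a \<in> D" "b \<in> D" "b \<noteq> 0" for a b using that by blast
  have bin: "x + y \<in> ?Q \<and> x * y \<in> ?Q" if xy: "x \<in> ?Q" "y \<in> ?Q" for x y
  proof -
    obtain a b c d where e: "x = a / b" "y = c / d" "a \<in> D" "b \<in> D" "c \<in> D" "d \<in> D" "b \<noteq> 0" "d \<noteq> 0"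
      using xy by blast
    have "x + y = (a * d + c * b) / (b * d)" "x * y = (a * c) / (b * d)"
      using e by (simp_all add: field_simps)
    moreover have "(a * d + c * b) / (b * d) \<in> ?Q" "(a * c) / (b * d) \<in> ?Q"
      using I[of "a * d + c * b" "b * d"] I[of "a * c" "b * d"] e(3-) D(2,3) by simp_all
    ultimately show ?thesis by simp
  qed
  have un: "- x \<in> ?Q \<and> inverse x \<in> ?Q" if x: "x \<in> ?Q" for x
  proof -
    obtain a b where e: "x = a / b" "a \<in> D" "b \<in> D" "b \<noteq> 0"
      using x by blast
    have "- x \<in> ?Q" using I[of "- a" b] e D by simp
    moreover have "inverse x \<in> ?Q"
      using I[of b a] I[of 0 1] e D(1) D0 by (cases "a = 0") auto
    ultimately show ?thesis ..
  qed
  have c: "0 \<in> ?Q" "1 \<in> ?Q" using I[of 0 1] I[of 1 1] D0 D(1) by auto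
  show ?thesis
    unfolding is_subfield_def
    by (intro conjI ballI c bin[THEN conjunct1] bin[THEN conjunct2] un[THEN conjunct1] un[THEN conjunct2])
qed

text \<open>The fractions over \<open>D\<close> form a subfield containing \<open>F\<close> and
  \<open>S\<close>, so they contain the smallest such subfield.\<close>

lemma adjoin_fraction:
  assumes D: "subring_set D" and "F \<subseteq> D" "S \<subseteq> D" and x: "x \<in> adjoin F S"
  obtains a b where "a \<in> D" "b \<in> D" "b \<noteq> 0" "x = a / b"
proof -
  let ?Q = "{a / b |a b. a \<in> D \<and> b \<in> D \<and> b \<noteq> 0}"
  have "D \<subseteq> ?Q"
  proof
    fix d assume "d \<in> D"
    then have "d / 1 \<in> ?Q" using D unfolding subring_set_def by (metis (mono_tags, lifting) mem_Collect_eq zero_neq_one)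
    then show "d \<in> ?Q" by simp
  qed
  then have "adjoin F S \<subseteq> ?Q"
    using assms by (intro adjoin_least is_subfield_fractions) auto
  then show ?thesis using x that by blast
qed

text \<open>Denominators are multiplied up one at a time. With \<open>D\<close> a set of polynomial
  values, this turns an algebraic relation over a generated field into one whose coefficients are
  values of polynomials.\<close>

lemma common_denominator:
  assumes D: "subring_set D" and "F \<subseteq> D" "S \<subseteq> D" and A: "finite A" "A \<subseteq> adjoin F S"
  shows "\<exists>b\<in>D. b \<noteq> 0 \<and> (\<forall>a\<in>A. a * b \<in> D)"
  using A
proof (induction A)
  case empty
  then show ?case using D by (metis empty_iff subring_set_def zero_neq_one)
next
  case (insert x A)
  then obtain b where b: "b \<in> D" "b \<noteq> 0" "\<And>a. a \<in> A \<Longrightarrow> a * b \<in> D" by auto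
  obtain c d where c: "c \<in> D" "d \<in> D" "d \<noteq> 0" "x = c / d"
    using adjoin_fraction[OF assms(1-3), of x] insert.prems by auto
  have m: "\<And>x y. x \<in> D \<Longrightarrow> y \<in> D \<Longrightarrow> x * y \<in> D" using D by (auto simp: subring_set_def)
  have "x * (b * d) = c * b" using c by simp
  then have "x * (b * d) \<in> D" using m b c by simp
  moreover have "a * (b * d) \<in> D" if "a \<in> A" for a
    using m[OF b(3)[OF that] c(2)] by (simp add: mult.assoc)
  ultimately have "\<forall>a\<in>insert x A. a * (b * d) \<in> D" by blast
  moreover have "b * d \<in> D" "b * d \<noteq> 0" using m b(1,2) c(2,3) by simp_all
  ultimately show ?case by blast
qed

section \<open>Polynomials in several variables and algebraic independence\<close>

definition monom_eval :: "('x \<Rightarrow> 'b::comm_ring_1) \<Rightarrow> ('x \<Rightarrow>\<^sub>0 nat) \<Rightarrow> 'b" where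
  "monom_eval v m = (\<Prod>x\<in>Poly_Mapping.keys m. v x ^ Poly_Mapping.lookup m x)"

text \<open>The coefficient map \<open>c\<close> and the assignment \<open>v\<close> are kept apart
  so that one formal polynomial can be evaluated in several rings; \<open>eval_self\<close> is the
  case where both are the identity.\<close>

definition mpoly_eval ::
  "('a::comm_ring_1 \<Rightarrow> 'b::comm_ring_1) \<Rightarrow> ('x \<Rightarrow> 'b) \<Rightarrow> (('x \<Rightarrow>\<^sub>0 nat) \<Rightarrow>\<^sub>0 'a) \<Rightarrow> 'b" where
  "mpoly_eval c v p = (\<Sum>m\<in>Poly_Mapping.keys p. c (Poly_Mapping.lookup p m) * monom_eval v m)"

lemma eval_self_eq: "eval_self p = mpoly_eval (\<lambda>a. a) (\<lambda>x. x) p"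
  by (simp add: eval_self_def mpoly_eval_def monom_eval_def)

lemma monom_eval_superset:
  assumes "finite A" "Poly_Mapping.keys m \<subseteq> A"
  shows "monom_eval v m = (\<Prod>x\<in>A. v x ^ Poly_Mapping.lookup m x)"
  unfolding monom_eval_def
  by (rule prod.mono_neutral_left) (use assms in \<open>auto simp: in_keys_iff\<close>)

lemma monom_eval_0 [simp]: "monom_eval v 0 = 1"
  by (simp add: monom_eval_def)

lemma monom_eval_single [simp]: "monom_eval v (Poly_Mapping.single x n) = v x ^ n"
  by (simp add: monom_eval_def)

lemma monom_eval_add: "monom_eval v (m + m') = monom_eval v m * monom_eval v m'"
proof -
  let ?A = "Poly_Mapping.keys m \<union> Poly_Mapping.keys m'"
  have "monom_eval v (m + m') = (\<Prod>x\<in>?A. v x ^ Poly_Mapping.lookup (m + m') x)"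
    by (rule monom_eval_superset) (simp_all add: keys_add)
  also have "\<dots> = (\<Prod>x\<in>?A. v x ^ Poly_Mapping.lookup m x) * (\<Prod>x\<in>?A. v x ^ Poly_Mapping.lookup m' x)"
    by (simp add: lookup_add power_add prod.distrib)
  also have "\<dots> = monom_eval v m * monom_eval v m'"
    by (simp add: monom_eval_superset[of ?A])
  finally show ?thesis .
qed

lemma monom_eval_sum: "monom_eval v (sum f A) = (\<Prod>x\<in>A. monom_eval v (f x))"
  by (induction A rule: infinite_finite_induct) (auto simp: monom_eval_add)

lemma mpoly_eval_0 [simp]: "mpoly_eval c v 0 = 0"
  by (simp add: mpoly_eval_def)

lemma mpoly_eval_single: "c 0 = 0 \<Longrightarrow> mpoly_eval c v (Poly_Mapping.single m a) = c a * monom_eval v m"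
  by (simp add: mpoly_eval_def)

lemma mpoly_eval_add:
  assumes "c 0 = 0" "\<And>a b. c (a + b) = c a + c b"
  shows "mpoly_eval c v (p + q) = mpoly_eval c v p + mpoly_eval c v q"
  unfolding mpoly_eval_def
  by (rule setsum_keys_plus_distrib) (simp_all add: assms distrib_right)

lemma mpoly_eval_sum:
  assumes "c 0 = 0" "\<And>a b. c (a + b) = c a + c b"
  shows "mpoly_eval c v (sum f A) = (\<Sum>x\<in>A. mpoly_eval c v (f x))"
  by (induction A rule: infinite_finite_induct) (auto simp: mpoly_eval_add[OF assms])

lemma mpoly_sum_single:
  "p = (\<Sum>m\<in>Poly_Mapping.keys p. Poly_Mapping.single m (Poly_Mapping.lookup p m))"
  by (rule poly_mapping_eqI) (simp add: lookup_sum lookup_single when_def in_keys_iff)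

lemma mpoly_eval_mult:
  assumes c: "unital_hom c"
  shows "mpoly_eval c v (p * q) = mpoly_eval c v p * mpoly_eval c v q"
proof -
  note c' = unital_homD(1)[OF c] unital_homD(3)[OF c]
  let ?s = "\<lambda>p m. Poly_Mapping.single m (Poly_Mapping.lookup p m)"
  have "p * q = (\<Sum>m\<in>Poly_Mapping.keys p. ?s p m) * (\<Sum>n\<in>Poly_Mapping.keys q. ?s q n)"
    using mpoly_sum_single[of p] mpoly_sum_single[of q] by simp
  then show ?thesis
    by (simp add: sum_product mult_single mpoly_eval_sum[where c=c, OF c'] mpoly_eval_single c'(1)
        unital_homD(4)[OF c] monom_eval_add)
      (simp add: mpoly_eval_def sum_product mult_ac)
qed

lemma mpoly_eval_uminus:
  assumes c: "unital_hom c"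
  shows "mpoly_eval c v (- p) = - mpoly_eval c v p"
proof -
  have "mpoly_eval c v (p + - p) = mpoly_eval c v p + mpoly_eval c v (- p)"
    by (rule mpoly_eval_add) (simp_all add: unital_homD[OF c])
  then show ?thesis by (simp add: minus_unique)
qed

lemma mpoly_eval_hom:
  assumes "unital_hom f"
  shows "f (mpoly_eval c v p) = mpoly_eval (\<lambda>a. f (c a)) (\<lambda>x. f (v x)) p"
  by (simp add: mpoly_eval_def monom_eval_def unital_hom_sum[OF assms] unital_homD(4)[OF assms]
      unital_hom_prod[OF assms] unital_hom_power[OF assms])

definition vars_in :: "'x set \<Rightarrow> (('x \<Rightarrow>\<^sub>0 nat) \<Rightarrow>\<^sub>0 'a::zero) \<Rightarrow> bool" where
  "vars_in S p \<longleftrightarrow> (\<forall>m\<in>Poly_Mapping.keys p. Poly_Mapping.keys m \<subseteq> S)"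

lemma vars_in_mono: "S \<subseteq> T \<Longrightarrow> vars_in S p \<Longrightarrow> vars_in T p"
  by (auto simp: vars_in_def)

lemma vars_in_0 [simp]: "vars_in S 0"
  by (simp add: vars_in_def)

lemma vars_in_single: "Poly_Mapping.keys m \<subseteq> S \<Longrightarrow> vars_in S (Poly_Mapping.single m a)"
  by (simp add: vars_in_def)

lemma vars_in_add: "vars_in S p \<Longrightarrow> vars_in S q \<Longrightarrow> vars_in S (p + q)"
  unfolding vars_in_def using keys_add[of p q] by blast

lemma vars_in_uminus: "vars_in S p \<Longrightarrow> vars_in S (- p)" for p :: "('x \<Rightarrow>\<^sub>0 nat) \<Rightarrow>\<^sub>0 'a::ab_group_add"
  by (simp add: vars_in_def in_keys_iff)

lemma vars_in_sum: "(\<And>x. x \<in> A \<Longrightarrow> vars_in S (f x)) \<Longrightarrow> vars_in S (sum f A)"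
  by (induction A rule: infinite_finite_induct) (auto simp: vars_in_add)

lemma vars_in_mult: "vars_in S p \<Longrightarrow> vars_in S q \<Longrightarrow> vars_in S (p * q)"
  for p :: "('x \<Rightarrow>\<^sub>0 nat) \<Rightarrow>\<^sub>0 'a::comm_ring_1"
  unfolding vars_in_def
proof
  fix m assume pq: "\<forall>m\<in>Poly_Mapping.keys p. Poly_Mapping.keys m \<subseteq> S"
    "\<forall>m\<in>Poly_Mapping.keys q. Poly_Mapping.keys m \<subseteq> S" and "m \<in> Poly_Mapping.keys (p * q)"
  then obtain a b where "m = a + b" "a \<in> Poly_Mapping.keys p" "b \<in> Poly_Mapping.keys q"
    using keys_mult[of p q] by blast
  then show "Poly_Mapping.keys m \<subseteq> S"
    using pq keys_add[of a b] by blast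
qed

lemma mpoly_eval_cong:
  assumes "vars_in S p" "\<And>x. x \<in> S \<Longrightarrow> v x = w x"
    and "\<And>m. m \<in> Poly_Mapping.keys p \<Longrightarrow> c (Poly_Mapping.lookup p m) = d (Poly_Mapping.lookup p m)"
  shows "mpoly_eval c v p = mpoly_eval d w p"
  unfolding mpoly_eval_def monom_eval_def
proof (intro sum.cong refl arg_cong2[where f="(*)"] prod.cong assms(3))
  fix m x assume "m \<in> Poly_Mapping.keys p" "x \<in> Poly_Mapping.keys m"
  then have "x \<in> S" using assms(1) unfolding vars_in_def by blast
  then show "v x ^ Poly_Mapping.lookup m x = w x ^ Poly_Mapping.lookup m x"
    using assms(2) by simp
qed

section \<open>Renaming variables and coefficients\<close>

definition monom_rename :: "('x \<Rightarrow> 'y) \<Rightarrow> ('x \<Rightarrow>\<^sub>0 nat) \<Rightarrow> ('y \<Rightarrow>\<^sub>0 nat)" where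
  "monom_rename v m = (\<Sum>x\<in>Poly_Mapping.keys m. Poly_Mapping.single (v x) (Poly_Mapping.lookup m x))"

definition mpoly_rename ::
  "('a \<Rightarrow> 'b) \<Rightarrow> ('x \<Rightarrow> 'y) \<Rightarrow> (('x \<Rightarrow>\<^sub>0 nat) \<Rightarrow>\<^sub>0 'a::zero) \<Rightarrow> (('y \<Rightarrow>\<^sub>0 nat) \<Rightarrow>\<^sub>0 'b::comm_ring_1)" where
  "mpoly_rename c v p =
     (\<Sum>m\<in>Poly_Mapping.keys p. Poly_Mapping.single (monom_rename v m) (c (Poly_Mapping.lookup p m)))"

lemma keys_monom_rename: "Poly_Mapping.keys (monom_rename v m) \<subseteq> v ` Poly_Mapping.keys m"
  unfolding monom_rename_def
  by (rule order_trans[OF keys_sum]) auto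

lemma vars_in_mpoly_rename: "vars_in S p \<Longrightarrow> vars_in (v ` S) (mpoly_rename c v p)"
  unfolding mpoly_rename_def
proof (intro vars_in_sum vars_in_single)
  fix m assume "vars_in S p" "m \<in> Poly_Mapping.keys p"
  then show "Poly_Mapping.keys (monom_rename v m) \<subseteq> v ` S"
    using keys_monom_rename[of v m] unfolding vars_in_def by blast
qed

text \<open>Renaming may merge monomials, but \<open>d\<close> acts before the merging and only
  \<open>c\<close> after it. So \<open>d\<close> can be any function, such as a chosen inverse of an
  embedding.\<close>

lemma mpoly_eval_rename:
  assumes "c 0 = 0" "\<And>a b. c (a + b) = c a + c b"
  shows "mpoly_eval c v (mpoly_rename d w p) = mpoly_eval (\<lambda>a. c (d a)) (\<lambda>x. v (w x)) p"
proof -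
  have "monom_eval v (monom_rename w m) = monom_eval (\<lambda>x. v (w x)) m" for m
    by (simp add: monom_rename_def monom_eval_sum) (simp add: monom_eval_def)
  then show ?thesis
    by (simp add: mpoly_rename_def mpoly_eval_sum[where c=c, OF assms] mpoly_eval_single assms(1))
      (simp add: mpoly_eval_def)
qed

text \<open>For a variable \<open>x\<close> in \<open>S\<close> the exponent of \<open>v x\<close>
  after renaming is the exponent of \<open>x\<close> before it, so the monomial can be read
  off.\<close>

lemma monom_rename_inj:
  assumes v: "inj_on v S"
  shows "inj_on (monom_rename v) {m. Poly_Mapping.keys m \<subseteq> S}"
proof -
  have l: "Poly_Mapping.lookup (monom_rename v m) (v x) = Poly_Mapping.lookup m x"
    if m: "Poly_Mapping.keys m \<subseteq> S" and x: "x \<in> S" for m x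
  proof -
    have "Poly_Mapping.lookup (monom_rename v m) (v x)
        = (\<Sum>y\<in>Poly_Mapping.keys m. if v y = v x then Poly_Mapping.lookup m y else 0)"
      by (simp add: monom_rename_def lookup_sum lookup_single when_def)
    also have "\<dots> = (\<Sum>y\<in>Poly_Mapping.keys m. if y = x then Poly_Mapping.lookup m y else 0)"
      using m x inj_onD[OF v] by (intro sum.cong) auto
    finally show ?thesis by (simp add: in_keys_iff)
  qed
  show ?thesis
  proof (rule inj_onI, rule poly_mapping_eqI)
    fix m n x assume a: "m \<in> {m. Poly_Mapping.keys m \<subseteq> S}" "n \<in> {m. Poly_Mapping.keys m \<subseteq> S}"
      and e: "monom_rename v m = monom_rename v n"
    show "Poly_Mapping.lookup m x = Poly_Mapping.lookup n x"
    proof (cases "x \<in> S")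
      case True
      then show ?thesis using l[of m x] l[of n x] a e by simp
    next
      case False
      then show ?thesis using a by (metis in_keys_iff mem_Collect_eq subsetD)
    qed
  qed
qed

text \<open>No two monomials merge under an injective renaming, so each coefficient of
  \<open>p\<close> survives as its image under \<open>c\<close>.\<close>

lemma mpoly_rename_eq_0:
  assumes v: "inj_on v S" and p: "vars_in S p" and "mpoly_rename c v p = 0"
    and c: "\<And>m. m \<in> Poly_Mapping.keys p \<Longrightarrow> c (Poly_Mapping.lookup p m) \<noteq> 0"
  shows "p = 0"
proof (rule ccontr)
  assume "p \<noteq> 0"
  then obtain m where m: "m \<in> Poly_Mapping.keys p"
    by (metis in_keys_iff lookup_zero poly_mapping_eqI)
  have "0 = Poly_Mapping.lookup (mpoly_rename c v p) (monom_rename v m)"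
    using assms(3) by simp
  also have "\<dots> = (\<Sum>n\<in>Poly_Mapping.keys p.
      if monom_rename v n = monom_rename v m then c (Poly_Mapping.lookup p n) else 0)"
    by (simp add: mpoly_rename_def lookup_sum lookup_single when_def)
  also have "\<dots> = (\<Sum>n\<in>Poly_Mapping.keys p. if n = m then c (Poly_Mapping.lookup p n) else 0)"
    using m p inj_onD[OF monom_rename_inj[OF v], of _ m] by (intro sum.cong) (auto simp: vars_in_def)
  also have "\<dots> = c (Poly_Mapping.lookup p m)" using m by simp
  finally show False using c m by simp
qed

text \<open>This trades polynomials whose coefficients and variables are elements of L for
  polynomials over K with variables from any index set. Independent sets of L and of M can then be
  tested on the same formal polynomials.\<close>

lemma alg_independent_iff_mpoly_eval:
  fixes c :: "'k::field \<Rightarrow> 'l::field"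
  assumes c: "field_hom c" and v: "inj_on v S"
  shows "alg_independent (range c) (v ` S) \<longleftrightarrow>
    (\<forall>p. vars_in S p \<longrightarrow> mpoly_eval c v p = 0 \<longrightarrow> p = 0)"
proof
  assume a: "alg_independent (range c) (v ` S)"
  show "\<forall>p. vars_in S p \<longrightarrow> mpoly_eval c v p = 0 \<longrightarrow> p = 0"
  proof (intro allI impI)
    fix p assume p: "vars_in S p" and 0: "mpoly_eval c v p = 0"
    let ?q = "mpoly_rename c v p"
    have "eval_self ?q = 0"
      using 0 by (simp add: eval_self_eq mpoly_eval_rename)
    moreover have "Poly_Mapping.lookup ?q m \<in> range c" for m
      using is_subfield_range[OF c]
      by (auto simp: mpoly_rename_def lookup_sum lookup_single when_def is_subfieldD intro!: is_subfield_sum)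
    moreover have "vars_in (v ` S) ?q" by (rule vars_in_mpoly_rename[OF p])
    ultimately have "?q = 0"
      using a by (simp add: alg_independent_def vars_in_def)
    then show "p = 0"
      by (rule mpoly_rename_eq_0[OF v p]) (simp add: field_hom_eq_0_iff[OF c] in_keys_iff)
  qed
next
  note u = field_hom_unital_hom[OF c]
  assume a: "\<forall>p. vars_in S p \<longrightarrow> mpoly_eval c v p = 0 \<longrightarrow> p = 0"
  show "alg_independent (range c) (v ` S)"
    unfolding alg_independent_def
  proof (intro allI impI)
    fix p assume p: "\<forall>m\<in>Poly_Mapping.keys p. Poly_Mapping.lookup p m \<in> range c \<and> Poly_Mapping.keys m \<subseteq> v ` S"
      and 0: "eval_self p = 0"
    \<comment> \<open>Both inverses are applied only to members of the images, where
      \<open>v\<close> and \<open>c\<close> undo them.\<close>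
    let ?w = "inv_into S v" and ?d = "inv_into UNIV c"
    let ?q = "mpoly_rename ?d ?w p"
    have pS: "vars_in (v ` S) p" using p by (simp add: vars_in_def)
    have cd: "c (?d (Poly_Mapping.lookup p m)) = Poly_Mapping.lookup p m"
      if "m \<in> Poly_Mapping.keys p" for m
      using p that by (simp add: f_inv_into_f)
    have "mpoly_eval c v ?q = mpoly_eval (\<lambda>a. c (?d a)) (\<lambda>x. v (?w x)) p"
      by (simp add: mpoly_eval_rename unital_homD[OF u])
    also have "\<dots> = eval_self p"
      unfolding eval_self_eq
      by (rule mpoly_eval_cong[OF pS]) (simp_all add: f_inv_into_f cd)
    finally have "mpoly_eval c v ?q = 0" using 0 by simp
    moreover have "vars_in S ?q"
      by (rule vars_in_mono[OF _ vars_in_mpoly_rename[OF pS]]) (auto simp: inv_into_into)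
    ultimately have "?q = 0" using a by blast
    then show "p = 0"
    proof (rule mpoly_rename_eq_0[OF inj_on_inv_into[OF subset_refl] pS])
      fix m assume m: "m \<in> Poly_Mapping.keys p"
      then show "?d (Poly_Mapping.lookup p m) \<noteq> 0"
        using cd[OF m] by (auto simp: unital_homD[OF u] in_keys_iff)
    qed
  qed
qed

text \<open>\<open>f\<close> commutes with evaluation and sends only 0 to 0, so the same formal
  polynomials vanish before and after applying it.\<close>

lemma alg_independent_image:
  assumes c: "field_hom c" and f: "field_hom f" and "alg_independent (range c) S"
  shows "alg_independent (f ` range c) (f ` S)"
proof -
  have "\<forall>p. vars_in S p \<longrightarrow> mpoly_eval c (\<lambda>x. x) p = 0 \<longrightarrow> p = 0"
    using alg_independent_iff_mpoly_eval[OF c, of "\<lambda>x. x" S] assms(3) by simp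
  then have "\<forall>p. vars_in S p \<longrightarrow> mpoly_eval (\<lambda>x. f (c x)) f p = 0 \<longrightarrow> p = 0"
    using mpoly_eval_hom[OF field_hom_unital_hom[OF f], of c "\<lambda>x. x"] f
    by (metis field_hom_eq_0_iff)
  then have "alg_independent (range (f \<circ> c)) (f ` S)"
    using alg_independent_iff_mpoly_eval[OF field_hom_comp[OF f c] inj_on_subset[OF field_hom_inj[OF f]], of S]
    by (simp add: o_def)
  then show ?thesis by (simp add: image_comp)
qed

lemma subring_set_mpoly_eval:
  assumes c: "unital_hom c"
  shows "subring_set {mpoly_eval c v p |p. vars_in S p}"
proof -
  have "mpoly_eval c v (Poly_Mapping.single 0 1) = 1"
    by (simp add: mpoly_eval_single[where c=c] unital_homD[OF c] del: single_one)
  then have "\<exists>p. 1 = mpoly_eval c v p \<and> vars_in S p"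
    by (metis keys_zero empty_subsetI vars_in_single)
  then show ?thesis
    unfolding subring_set_def
    by (auto simp: mpoly_eval_mult[OF c, symmetric] mpoly_eval_uminus[OF c, symmetric]
        mpoly_eval_add[where c=c, symmetric] unital_homD[OF c])
      (blast intro: vars_in_mult vars_in_add vars_in_uminus)+
qed

lemma mpoly_eval_generators:
  assumes c: "unital_hom c"
  shows "range c \<subseteq> {mpoly_eval c v p |p. vars_in S p}" "v ` S \<subseteq> {mpoly_eval c v p |p. vars_in S p}"
proof -
  have "mpoly_eval c v (Poly_Mapping.single 0 a) = c a" for a
    by (simp add: mpoly_eval_single[where c=c] unital_homD[OF c])
  then show "range c \<subseteq> {mpoly_eval c v p |p. vars_in S p}"
    by (smt (verit, best) image_subsetI keys_zero empty_subsetI mem_Collect_eq vars_in_single)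
  have "mpoly_eval c v (Poly_Mapping.single (Poly_Mapping.single x 1) 1) = v x" for x
    by (simp add: mpoly_eval_single[where c=c] unital_homD[OF c])
  moreover have "vars_in S (Poly_Mapping.single (Poly_Mapping.single x (1::nat)) (1::'a))" if "x \<in> S" for x
    using that by (intro vars_in_single) simp
  ultimately show "v ` S \<subseteq> {mpoly_eval c v p |p. vars_in S p}"
    by (smt (verit, best) image_subsetI mem_Collect_eq)
qed

text \<open>After clearing denominators, a relation of \<open>s\<close> over \<open>K(T)\<close> is a polynomial relation among
  \<open>insert s T\<close>; evaluating its formal polynomial at \<open>s = X\<close> in \<open>L[X]\<close> returns a nonzero multiple
  of the given one.\<close>

lemma alg_independent_imp_not_algebraic:
  fixes c :: "'k::field \<Rightarrow> 'l::field"
  assumes c: "field_hom c" and S: "alg_independent (range c) S" and s: "s \<in> S" "T \<subseteq> S" "s \<notin> T"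
  shows "\<not> algebraic_over (adjoin (range c) T) s"
proof
  note u = field_hom_unital_hom[OF c]
  assume "algebraic_over (adjoin (range c) T) s"
  then obtain P where P: "P \<noteq> 0" "\<And>n. Polynomial.coeff P n \<in> adjoin (range c) T" "poly P s = 0"
    by (auto simp: algebraic_over_def)
  let ?D = "{mpoly_eval c (\<lambda>x. x) p |p. vars_in T p}" and ?N = "Polynomial.degree P"
  obtain b where b: "b \<in> ?D" "b \<noteq> 0" "\<forall>a\<in>Polynomial.coeff P ` {..?N}. a * b \<in> ?D"
    using common_denominator[OF subring_set_mpoly_eval[OF u] mpoly_eval_generators(1)[OF u],
        of T "\<lambda>x. x" T "Polynomial.coeff P ` {..?N}"] mpoly_eval_generators(2)[OF u, of "\<lambda>x. x" T] P(2)
    by auto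
  then have "\<forall>n\<in>{..?N}. \<exists>p. vars_in T p \<and> Polynomial.coeff P n * b = mpoly_eval c (\<lambda>x. x) p"
    by auto
  then obtain p where p: "\<And>n. n \<le> ?N \<Longrightarrow> vars_in T (p n)"
    "\<And>n. n \<le> ?N \<Longrightarrow> Polynomial.coeff P n * b = mpoly_eval c (\<lambda>x. x) (p n)"
    by (metis atMost_iff)
  \<comment> \<open>The variable \<open>s\<close> takes the place of the indeterminate of
    \<open>P\<close>. The value formula for \<open>R\<close> is proved for arbitrary targets because
    \<open>R\<close> is evaluated both in L and in L[X].\<close>
  define R where "R = (\<Sum>n\<le>?N. p n * Poly_Mapping.single (Poly_Mapping.single s n) 1)"
  have R: "mpoly_eval d v R = (\<Sum>n\<le>?N. mpoly_eval d v (p n) * v s ^ n)"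
    if d: "unital_hom d" for d and v :: "'l \<Rightarrow> 'z::comm_ring_1"
    unfolding R_def by (simp add: mpoly_eval_sum[where c=d] mpoly_eval_mult mpoly_eval_single[where c=d] d unital_homD[OF d])
  have "mpoly_eval c (\<lambda>x. x) R = (\<Sum>n\<le>?N. Polynomial.coeff P n * b * s ^ n)"
    using p(2) by (simp add: R[OF u])
  also have "\<dots> = b * poly P s"
    by (simp add: poly_altdef sum_distrib_left mult_ac)
  finally have "mpoly_eval c (\<lambda>x. x) R = 0" using P(3) by simp
  moreover have "vars_in S R"
    unfolding R_def
    by (intro vars_in_sum vars_in_mult vars_in_single)
      (use s p(1) in \<open>auto intro: vars_in_mono\<close>)
  ultimately have R0: "R = 0"
    using alg_independent_iff_mpoly_eval[OF c, of "\<lambda>x. x" S] S by simp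
  let ?v = "(\<lambda>x. [:x:])(s := [:0, 1:])"
  have ud: "unital_hom (\<lambda>a. [:c a:])"
    by (rule unital_hom_comp[OF unital_hom_const_poly u])
  \<comment> \<open>As \<open>s\<close> lies outside \<open>T\<close>, all variables of
    \<open>p n\<close> go to constants, so X does not enter the coefficients.\<close>
  have "mpoly_eval (\<lambda>a. [:c a:]) ?v (p n) = [:Polynomial.coeff P n * b:]" if n: "n \<le> ?N" for n
  proof -
    have "mpoly_eval (\<lambda>a. [:c a:]) ?v (p n) = mpoly_eval (\<lambda>a. [:c a:]) (\<lambda>x. [:x:]) (p n)"
      using s(3) by (intro mpoly_eval_cong[OF p(1)[OF n]]) auto
    then show ?thesis
      using mpoly_eval_hom[OF unital_hom_const_poly, of c "\<lambda>x. x" "p n"] p(2)[OF n] by simp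
  qed
  then have "mpoly_eval (\<lambda>a. [:c a:]) ?v R = (\<Sum>n\<le>?N. [:Polynomial.coeff P n * b:] * [:0, 1:] ^ n)"
    by (simp add: R[OF ud])
  also have "\<dots> = (\<Sum>n\<le>?N. Polynomial.monom (Polynomial.coeff P n * b) n)"
    by (simp add: monom_altdef)
  also have "\<dots> = Polynomial.smult b P"
    by (rule poly_eqI) (auto simp: Polynomial.coeff_sum Polynomial.coeff_eq_0)
  finally have "Polynomial.smult b P = 0" using R0 by simp
  then show False using b(2) P(1) by simp
qed

text \<open>Both fields consist of values of the same formal fractions, which vanish or not simultaneously.\<close>

lemma purely_transcendental_iso:
  fixes i :: "'k::field \<Rightarrow> 'l::field" and j :: "'k \<Rightarrow> 'm::field"
  assumes i: "field_hom i" and j: "field_hom j"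
    and S: "alg_independent (range i) S" "adjoin (range i) S = UNIV"
    and T: "alg_independent (range j) T" "adjoin (range j) T = UNIV"
    and h: "bij_betw h S T"
  obtains \<phi> where "field_hom \<phi>" "bij \<phi>" "\<And>k. \<phi> (i k) = j k"
proof -
  note ui = field_hom_unital_hom[OF i] and uj = field_hom_unital_hom[OF j]
  let ?e = "mpoly_eval i (\<lambda>x. x)" and ?f = "mpoly_eval j h"
  have hS: "h ` S = T" "inj_on h S" using h by (auto simp: bij_betw_def)
  have e0: "p = 0" if "vars_in S p" "?e p = 0" for p
    using alg_independent_iff_mpoly_eval[OF i, of "\<lambda>x. x" S] S(1) that by simp
  have f0: "p = 0" if "vars_in S p" "?f p = 0" for p
    using alg_independent_iff_mpoly_eval[OF j hS(2)] T(1) that hS(1) by simp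
  note e = mpoly_eval_mult[OF ui] mpoly_eval_uminus[OF ui] mpoly_eval_add[where c=i, OF unital_homD(1,3)[OF ui]]
  note f = mpoly_eval_mult[OF uj] mpoly_eval_uminus[OF uj] mpoly_eval_add[where c=j, OF unital_homD(1,3)[OF uj]]
  note vI = vars_in_mult vars_in_add vars_in_uminus
  have repr: "\<exists>p q. vars_in S p \<and> vars_in S q \<and> ?e q \<noteq> 0 \<and> x = ?e p / ?e q" for x
  proof -
    have "x \<in> adjoin (range i) S" by (simp add: S)
    then obtain a b where "a \<in> {?e p |p. vars_in S p}" "b \<in> {?e p |p. vars_in S p}" "b \<noteq> 0" "x = a / b"
      by (rule adjoin_fraction[OF subring_set_mpoly_eval[OF ui] mpoly_eval_generators(1)[OF ui]
            mpoly_eval_generators(2)[OF ui, of "\<lambda>x. x", simplified]])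
    then show ?thesis by blast
  qed
  then obtain P Q where PQ: "\<And>x. vars_in S (P x)" "\<And>x. vars_in S (Q x)" "\<And>x. ?e (Q x) \<noteq> 0"
    "\<And>x. x = ?e (P x) / ?e (Q x)"
    by metis
  define \<phi> where "\<phi> x = ?f (P x) / ?f (Q x)" for x
  have nz: "?f q \<noteq> 0" if "vars_in S q" "?e q \<noteq> 0" for q
    using f0[OF that(1)] that(2) by auto
  have xQ: "x * ?e (Q x) = ?e (P x)" for x
    using PQ(3)[of x] PQ(4)[of x] by (simp add: field_simps)
  \<comment> \<open>The value of \<open>\<phi>\<close> does not depend on the chosen fraction: the
    cross-multiplied difference vanishes in L, so it is the zero polynomial by independence of
    \<open>S\<close>, so it vanishes in M. Each later property of \<open>\<phi>\<close> picks a
    convenient fraction.\<close>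
  have \<phi>: "\<phi> x = ?f p / ?f q" if "vars_in S p" "vars_in S q" "?e q \<noteq> 0" "x * ?e q = ?e p" for x p q
  proof -
    have "?e (P x * q + - (p * Q x)) = ?e (P x) * ?e q - ?e p * ?e (Q x)"
      by (simp only: e diff_conv_add_uminus)
    also have "\<dots> = 0" by (simp add: xQ[symmetric] that(4)[symmetric] mult_ac)
    finally have "P x * q + - (p * Q x) = 0"
      using that PQ by (intro e0 vI) auto
    then have "?f (P x * q + - (p * Q x)) = 0" by (simp only: mpoly_eval_0)
    then have "?f (P x) * ?f q + - (?f p * ?f (Q x)) = 0" by (simp only: f)
    then have "?f (P x) * ?f q = ?f p * ?f (Q x)" by simp
    then show ?thesis
      using nz[OF PQ(2,3), of x] nz[OF that(2,3)] by (simp add: \<phi>_def field_simps)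
  qed
  have fQ: "?f (Q x) \<noteq> 0" for x using nz PQ(2,3) .
  have add: "\<phi> (x + y) = \<phi> x + \<phi> y" for x y
  proof -
    have "(x + y) * ?e (Q x * Q y) = x * ?e (Q x) * ?e (Q y) + y * ?e (Q y) * ?e (Q x)"
      by (simp add: e algebra_simps)
    then have "\<phi> (x + y) = ?f (P x * Q y + P y * Q x) / ?f (Q x * Q y)"
      by (intro \<phi> vI PQ) (simp_all add: e xQ PQ)
    then show ?thesis using fQ[of x] fQ[of y] by (simp add: f \<phi>_def field_simps)
  qed
  have mult: "\<phi> (x * y) = \<phi> x * \<phi> y" for x y
  proof -
    have "(x * y) * ?e (Q x * Q y) = (x * ?e (Q x)) * (y * ?e (Q y))"
      by (simp add: e algebra_simps)
    then have "\<phi> (x * y) = ?f (P x * P y) / ?f (Q x * Q y)"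
      by (intro \<phi> vI PQ) (simp_all add: e xQ PQ)
    then show ?thesis by (simp add: f \<phi>_def)
  qed
  let ?c = "\<lambda>k. Poly_Mapping.single 0 k :: ('l \<Rightarrow>\<^sub>0 nat) \<Rightarrow>\<^sub>0 'k"
  have c: "?e (?c k) = i k" "?f (?c k) = j k" "vars_in S (?c k)" for k
    by (simp_all add: mpoly_eval_single[where c=i] mpoly_eval_single[where c=j] unital_homD[OF ui] unital_homD[OF uj] vars_in_single)
  have \<phi>i: "\<phi> (i k) = j k" for k
  proof -
    have "\<phi> (i k) = ?f (?c k) / ?f (?c 1)"
      by (intro \<phi> c(3)) (simp_all add: c unital_homD[OF ui] del: single_one)
    then show ?thesis by (simp add: c unital_homD[OF uj] del: single_one)
  qed
  have one: "\<phi> 1 = 1" using \<phi>i[of 1] by (simp add: unital_homD[OF ui] unital_homD[OF uj])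
  have hom: "field_hom \<phi>" using add mult one by (simp add: field_hom_def)
  have \<phi>s: "\<phi> s = h s" if s: "s \<in> S" for s
  proof -
    let ?s = "Poly_Mapping.single (Poly_Mapping.single s 1) 1 :: ('l \<Rightarrow>\<^sub>0 nat) \<Rightarrow>\<^sub>0 'k"
    have s': "?e ?s = s" "?f ?s = h s" "vars_in S ?s"
      using s by (simp_all add: mpoly_eval_single[where c=i] mpoly_eval_single[where c=j] unital_homD[OF ui] unital_homD[OF uj] vars_in_single)
    have "\<phi> s = ?f ?s / ?f (?c 1)"
      by (intro \<phi> c(3) s'(3)) (simp_all only: c s' unital_homD[OF ui] mult_1_right one_neq_zero not_False_eq_True)
    then show ?thesis by (simp only: c s' unital_homD[OF uj] div_by_1)
  qed
  \<comment> \<open>The range is a subfield containing \<open>range j\<close> and \<open>T\<close>,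
    which generate M.\<close>
  have "UNIV = adjoin (range j) T" by (simp add: T)
  also have "\<dots> \<subseteq> range \<phi>"
    using \<phi>i \<phi>s hS by (intro adjoin_least is_subfield_range hom) (metis image_subsetI rangeI)+
  finally have "surj \<phi>" by auto
  then have "bij \<phi>" using field_hom_inj[OF hom] by (simp add: bij_def)
  then show ?thesis using that hom \<phi>i by blast
qed

section \<open>Exchange property and transcendence degree\<close>

lemma subring_set_poly_eval:
  assumes F: "is_subfield F"
  shows "subring_set {poly p b |p. \<forall>n. Polynomial.coeff p n \<in> F}"
proof -
  have "\<exists>p. 1 = poly p b \<and> (\<forall>n. Polynomial.coeff p n \<in> F)"
    by (rule exI[of _ 1]) (simp add: is_subfieldD[OF F] Polynomial.coeff_1)
  moreover have "\<forall>n. Polynomial.coeff (p + q) n \<in> F" "\<forall>n. Polynomial.coeff (p * q) n \<in> F"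
    "\<forall>n. Polynomial.coeff (- p) n \<in> F"
    if "\<forall>n. Polynomial.coeff p n \<in> F" "\<forall>n. Polynomial.coeff q n \<in> F" for p q
    using that by (auto simp: coeff_mult is_subfieldD[OF F] intro!: is_subfield_sum[OF F])
  ultimately show ?thesis
    unfolding subring_set_def
    by (auto simp flip: poly_add poly_mult poly_minus)
qed

lemma poly_eval_generators:
  assumes F: "is_subfield F"
  shows "F \<subseteq> {poly p b |p. \<forall>n. Polynomial.coeff p n \<in> F}" "{b} \<subseteq> {poly p b |p. \<forall>n. Polynomial.coeff p n \<in> F}"
proof -
  have "\<exists>p. a = poly p b \<and> (\<forall>n. Polynomial.coeff p n \<in> F)" if "a \<in> F" for a
    using that by (intro exI[of _ "[:a:]"]) (auto simp: Polynomial.coeff_pCons is_subfieldD[OF F] split: nat.splits)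
  then show "F \<subseteq> {poly p b |p. \<forall>n. Polynomial.coeff p n \<in> F}" by auto
  have "\<exists>p. b = poly p b \<and> (\<forall>n. Polynomial.coeff p n \<in> F)"
    by (intro exI[of _ "[:0, 1:]"]) (auto simp: Polynomial.coeff_pCons is_subfieldD[OF F] split: nat.splits)
  then show "{b} \<subseteq> {poly p b |p. \<forall>n. Polynomial.coeff p n \<in> F}" by auto
qed

text \<open>After clearing denominators, the relation of \<open>s\<close> over \<open>F(b)\<close> becomes a polynomial in two
  variables over \<open>F\<close>, which is read as a relation of \<open>b\<close> over \<open>F(s)\<close>.\<close>

lemma algebraic_over_exchange:
  assumes F: "is_subfield F" and s: "algebraic_over (adjoin F {b}) s" and ns: "\<not> algebraic_over F s"
  shows "algebraic_over (adjoin F {s}) b"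
proof -
  obtain P where P: "P \<noteq> 0" "\<And>n. Polynomial.coeff P n \<in> adjoin F {b}" "poly P s = 0"
    using s by (auto simp: algebraic_over_def)
  let ?D = "{poly p b |p. \<forall>n. Polynomial.coeff p n \<in> F}" and ?N = "Polynomial.degree P"
  obtain d where d: "d \<in> ?D" "d \<noteq> 0" "\<forall>a\<in>Polynomial.coeff P ` {..?N}. a * d \<in> ?D"
    using common_denominator[OF subring_set_poly_eval[OF F] poly_eval_generators[OF F],
        of "Polynomial.coeff P ` {..?N}"] P(2) by blast
  then have "\<forall>n\<in>{..?N}. \<exists>p. (\<forall>k. Polynomial.coeff p k \<in> F) \<and> Polynomial.coeff P n * d = poly p b"
    by blast
  then obtain p where p: "\<And>n k. n \<le> ?N \<Longrightarrow> Polynomial.coeff (p n) k \<in> F"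
    "\<And>n. n \<le> ?N \<Longrightarrow> Polynomial.coeff P n * d = poly (p n) b"
    by (metis atMost_iff)
  define Q where "Q = (\<Sum>n\<le>?N. Polynomial.smult (s ^ n) (p n))"
  have "poly Q b = (\<Sum>n\<le>?N. s ^ n * (Polynomial.coeff P n * d))"
    unfolding Q_def poly_sum by (intro sum.cong refl) (simp add: p(2))
  also have "\<dots> = d * poly P s"
    by (simp add: poly_altdef sum_distrib_left mult_ac)
  finally have 1: "poly Q b = 0" using P(3) by simp
  have E: "is_subfield (adjoin F {s})" by (rule is_subfield_adjoin)
  have "F \<subseteq> adjoin F {s}" "s \<in> adjoin F {s}"
    using adjoin_upper[of F "{s}"] adjoin_upper[of "{s}" F] by auto
  then have 2: "Polynomial.coeff Q k \<in> adjoin F {s}" for k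
    unfolding Q_def Polynomial.coeff_sum
    using p(1) by (auto intro!: is_subfield_sum[OF E] is_subfieldD(4)[OF E] is_subfield_power[OF E])
  have "Q \<noteq> 0"
  proof
    assume Q0: "Q = 0"
    have "Polynomial.coeff (p n) k = 0" if n: "n \<le> ?N" for n k
    proof -
      \<comment> \<open>The double sum is regrouped: for fixed \<open>k\<close>, the coefficients of
        the k-th power of the second variable form a polynomial over \<open>F\<close> with root
        \<open>s\<close>. It must be zero, since \<open>s\<close> is not algebraic over
        \<open>F\<close>.\<close>
      let ?q = "\<Sum>n\<le>?N. Polynomial.monom (Polynomial.coeff (p n) k) n"
      have "poly ?q s = Polynomial.coeff Q k"
        by (simp add: Q_def Polynomial.coeff_sum poly_sum poly_monom mult.commute)
      then have q: "poly ?q s = 0" using Q0 by simp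
      have c: "Polynomial.coeff ?q m = (if m \<le> ?N then Polynomial.coeff (p m) k else 0)" for m
        by (auto simp: Polynomial.coeff_sum)
      then have "\<forall>m. Polynomial.coeff ?q m \<in> F"
        using p(1) by (simp add: is_subfieldD(1)[OF F])
      then have "?q = 0" using q ns unfolding algebraic_over_def by blast
      then show ?thesis using c[of n] n by simp
    qed
    then have "p n = 0" if "n \<le> ?N" for n using that by (simp add: poly_eq_iff)
    then have "Polynomial.coeff P ?N * d = 0" using p(2)[of ?N] by simp
    then show False using d(2) P(1) by simp
  qed
  then show ?thesis using 1 2 unfolding algebraic_over_def by blast
qed

section \<open>Transitivity of algebraic dependence, by way of ring records\<close>

context
  fixes R :: "'a::field ring"
  defines "R \<equiv> ring_of_type_algebra"
begin

interpretation R: field R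
  unfolding R_def by (rule field_from_type_algebra)

lemma R_simps: "carrier R = UNIV" "mult R = (*)" "one R = 1" "zero R = 0" "add R = (+)"
  by (simp_all add: R_def ring_of_type_algebra_def fun_eq_iff)

lemma R_uminus: "a_inv R x = - x"
  by (rule R.minus_equality) (simp_all add: R_simps)

lemma R_inv: "x \<noteq> 0 \<Longrightarrow> m_inv R x = inverse x"
  by (rule R.inv_char) (simp_all add: R_simps)

lemma R_pow: "x [^]\<^bsub>R\<^esub> (n::nat) = x ^ n"
  by (induction n) (simp_all add: R_simps mult.commute)

lemma R_subring: "is_subfield F \<Longrightarrow> subring F R"
  by (rule R.subringI) (auto simp: R_simps R_uminus is_subfieldD)

lemma R_subfield: "is_subfield F \<Longrightarrow> subfield F R"
  by (rule R.subfieldI') (auto simp: R_subring R_simps R_inv is_subfieldD)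

lemma R_subfieldD: "subfield F R \<Longrightarrow> is_subfield F"
proof -
  assume F: "subfield F R"
  note s = subringE[OF subfieldE(1)[OF F]]
  have "inverse x \<in> F" if "x \<in> F" for x
  proof (cases "x = 0")
    case True
    then show ?thesis using that by simp
  next
    case False
    then show ?thesis using R.subfield_m_inv(1)[OF F, of x] that by (simp add: R_simps R_inv)
  qed
  then show ?thesis
    using s(2,3,5-7) by (auto simp: is_subfield_def R_simps R_uminus)
qed

text \<open>The list polynomials of the ring record start with the leading coefficient, whereas
  \<open>Poly\<close> starts with the constant term; hence \<open>rev\<close>.\<close>

lemma R_eval: "R.eval l x = poly (Poly (rev l)) x"
proof (induction l)
  case (Cons a l)
  have "poly (Poly (rev l @ [a])) x = poly (Poly (rev l)) x + a * x ^ length l"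
    by (simp add: Poly_append poly_monom mult.commute)
  then show ?case using Cons by (simp add: R_simps R_pow)
qed (simp add: R_simps)

lemma R_algebraic:
  fixes F :: "'a set"
  assumes F: "is_subfield F"
  shows "(R.algebraic over F) x \<longleftrightarrow> algebraic_over F x"
proof
  assume "(R.algebraic over F) x"
  then obtain l where l: "l \<in> carrier (univ_poly R F)" "l \<noteq> []" "R.eval l x = \<zero>\<^bsub>R\<^esub>"
    using R.algebraicE[OF R_subring[OF F]] by (auto simp: R_simps)
  then have s: "set l \<subseteq> F" "hd l \<noteq> 0" by (auto simp: univ_poly_def polynomial_def R_simps)
  have "Polynomial.coeff (Poly (rev l)) n \<in> F" for n
    using s(1) by (auto simp: coeff_Poly_eq nth_default_def is_subfieldD(1)[OF F])
      (metis length_rev nth_mem set_rev subsetD)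
  moreover have "Poly (rev l) \<noteq> 0"
  proof
    assume "Poly (rev l) = 0"
    then have "Polynomial.coeff (Poly (rev l)) (length l - 1) = 0" by simp
    then show False using s(2) l(2) by (simp add: coeff_Poly_eq nth_default_def rev_nth hd_conv_nth)
  qed
  ultimately show "algebraic_over F x"
    using l(3) unfolding algebraic_over_def R_eval by (auto simp: R_simps)
next
  assume "algebraic_over F x"
  then obtain p where p: "p \<noteq> 0" "\<And>n. Polynomial.coeff p n \<in> F" "poly p x = 0"
    by (auto simp: algebraic_over_def)
  have "set (coeffs p) \<subseteq> F" using p(2) by (auto simp: coeffs_def)
  then have "rev (coeffs p) \<in> carrier (univ_poly R F)"
    using p(1) by (auto simp: univ_poly_def polynomial_def R_simps hd_rev last_coeffs_eq_coeff_degree)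
  then show "(R.algebraic over F) x"
    using p(1,3) by (intro R.algebraicI) (auto simp: R_eval R_simps)
qed

text \<open>A simple extension by an algebraic element has finite dimension, and finite dimension
  passes through the tower F, F(b), F(b)(x). Every element of a finite-dimensional extension is
  algebraic.\<close>

lemma algebraic_over_trans:
  fixes F :: "'a set"
  assumes F: "is_subfield F" and b: "algebraic_over F b" and x: "algebraic_over (adjoin F {b}) x"
  shows "algebraic_over F x"
proof -
  let ?E = "R.simple_extension F b"
  note Fs = R_subfield[OF F]
  have C: "y \<in> carrier R" for y by (simp add: R_simps)
  have b': "(R.algebraic over F) b" using b by (simp add: R_algebraic[OF F])
  have E: "subfield ?E R" using R.simple_extension_is_subfield[OF Fs C] b' by simp
  have "F \<subseteq> ?E" using R.simple_extension_incl[of F b] C by (simp add: R_simps)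
  moreover have "{b} \<subseteq> ?E" using R.simple_extension_mem[OF R_subring[OF F] C] by simp
  ultimately have "adjoin F {b} \<subseteq> ?E" by (intro adjoin_least R_subfieldD E)
  then have "algebraic_over ?E x" using x algebraic_over_mono by blast
  then have x': "(R.algebraic over ?E) x" by (simp add: R_algebraic[OF R_subfieldD[OF E]])
  have "R.finite_dimension F ?E" using R.finite_dimension_simple_extension[OF Fs C] b' by simp
  moreover have "R.finite_dimension ?E (R.simple_extension ?E x)"
    using R.finite_dimension_simple_extension[OF E C] x' by simp
  ultimately have "R.finite_dimension F (R.simple_extension ?E x)"
    by (rule R.telescopic_base_dim(1)[OF Fs E])
  then have "(R.algebraic over F) x"
    by (rule R.finite_dimension_imp_algebraic[OF Fs R.simple_extension_is_subring[OF subfieldE(1)[OF E] C]])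
      (rule R.simple_extension_mem[OF subfieldE(1)[OF E] C])
  then show ?thesis by (simp add: R_algebraic[OF F])
qed

end

text \<open>Elements of \<open>Y\<close> enter one at a time, and each pushes out one element of
  \<open>B\<close>, while all of L stays algebraic over what is generated.\<close>

lemma steinitz_exchange:
  fixes c :: "'k::field \<Rightarrow> 'l::field"
  assumes c: "field_hom c" and S: "alg_independent (range c) S"
    and B: "finite B" "\<And>x. algebraic_over (adjoin (range c) B) x"
    and Y: "finite Y" "Y \<subseteq> S"
  shows "\<exists>C\<subseteq>B. card C + card Y = card B \<and> (\<forall>x. algebraic_over (adjoin (range c) (Y \<union> C)) x)"
  using Y
proof (induction Y)
  case empty
  then show ?case using B by auto
next
  case (insert s Y)
  let ?K = "adjoin (range c)"
  obtain C where C: "C \<subseteq> B" "card C + card Y = card B" "\<And>x. algebraic_over (?K (Y \<union> C)) x"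
    using insert by auto
  have fC: "finite C" using C(1) B(1) finite_subset by blast
  \<comment> \<open>A smallest \<open>D\<close> on which \<open>s\<close> depends together with
    \<open>Y\<close> is nonempty by independence of \<open>S\<close>. By minimality, dropping any
    \<open>b\<close> from it breaks the dependence, which is the hypothesis of the exchange
    lemma.\<close>
  let ?good = "\<lambda>D. D \<subseteq> C \<and> algebraic_over (?K (Y \<union> D)) s"
  define D where "D = arg_min card ?good"
  have g: "?good C" using C(3) by simp
  have D: "D \<subseteq> C" "algebraic_over (?K (Y \<union> D)) s"
    using arg_min_natI[of ?good, OF g, of card] by (auto simp: D_def)
  have Dmin: "\<not> algebraic_over (?K (Y \<union> D')) s" if "D' \<subset> D" for D'
  proof
    assume "algebraic_over (?K (Y \<union> D')) s"
    then have "card D \<le> card D'"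
      unfolding D_def using that D(1) by (intro arg_min_nat_le) auto
    moreover have "card D' < card D"
      using that D(1) fC by (meson psubset_card_mono finite_subset)
    ultimately show False by simp
  qed
  have "\<not> algebraic_over (?K Y) s"
    using insert by (intro alg_independent_imp_not_algebraic[OF c S]) auto
  then have "D \<noteq> {}" using D(2) by auto
  then obtain b where b: "b \<in> D" by auto
  let ?F = "?K (Y \<union> (D - {b}))" and ?E = "?K (insert s Y \<union> (C - {b}))"
  have "adjoin ?F {b} = ?K (Y \<union> D)"
    unfolding adjoin_adjoin using b by (intro arg_cong[where f="?K"]) auto
  then have "algebraic_over (adjoin ?F {b}) s" using D(2) by simp
  moreover have "\<not> algebraic_over ?F s" using Dmin[of "D - {b}"] b by blast
  ultimately have "algebraic_over (adjoin ?F {s}) b"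
    by (rule algebraic_over_exchange[OF is_subfield_adjoin])
  moreover have "adjoin ?F {s} \<subseteq> ?E"
    unfolding adjoin_adjoin using D(1) by (intro adjoin_mono) auto
  ultimately have bE: "algebraic_over ?E b" using algebraic_over_mono by blast
  \<comment> \<open>Returning \<open>b\<close> to the new set recovers the old one, and
    \<open>b\<close> is algebraic over \<open>?E\<close>; transitivity removes it again.\<close>
  have "?K (Y \<union> C) \<subseteq> adjoin ?E {b}"
    unfolding adjoin_adjoin by (intro adjoin_mono) auto
  then have "algebraic_over ?E x" for x
    using algebraic_over_trans[OF is_subfield_adjoin bE] algebraic_over_mono C(3) by blast
  moreover have "card (C - {b}) + card (insert s Y) = card B"
    using b D(1) fC C(2) insert.hyps card_gt_0_iff[of C] by (auto simp: card_Diff_singleton)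
  ultimately show ?case using C(1) by blast
qed

text \<open>Exchange bounds every finite subset of \<open>S\<close>; an infinite \<open>S\<close>
  would have finite subsets of more than \<open>card B\<close> elements.\<close>

lemma alg_independent_card_le:
  fixes c :: "'k::field \<Rightarrow> 'l::field"
  assumes c: "field_hom c" and S: "alg_independent (range c) S"
    and B: "finite B" "\<And>x. algebraic_over (adjoin (range c) B) x"
  shows "finite S \<and> card S \<le> card B"
proof -
  have le: "card Y \<le> card B" if "finite Y" "Y \<subseteq> S" for Y
    using steinitz_exchange[OF c S B that] by auto
  moreover have "finite S"
    using le infinite_arbitrarily_large[of S "Suc (card B)"] by (metis not_less_eq_eq order_refl)
  ultimately show ?thesis by blast
qed

lemma algebraic_over_self: "is_subfield F \<Longrightarrow> x \<in> F \<Longrightarrow> algebraic_over F x"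
  unfolding algebraic_over_def
  by (intro exI[of _ "[:- x, 1:]"]) (auto simp: Polynomial.coeff_pCons is_subfieldD split: nat.splits)

text \<open>The generating set and the base witnessing the degree are both independent, and L is
  algebraic over each, so the cardinality bound applies in both directions.\<close>

lemma purely_transcendental_trdeg_generators:
  assumes c: "field_hom c" and "purely_transcendental (range c) UNIV" "has_finite_trdeg (range c) UNIV n"
  obtains S where "alg_independent (range c) S" "adjoin (range c) S = UNIV" "finite S" "card S = n"
proof -
  obtain S where S: "alg_independent (range c) S" "adjoin (range c) S = UNIV"
    using assms(2) by (auto simp: purely_transcendental_def)
  obtain B where B: "alg_independent (range c) B" "\<And>x. algebraic_over (adjoin (range c) B) x"
      "finite B" "card B = n"
    using assms(3) by (auto simp: has_finite_trdeg_def transcendence_base_def)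
  have "finite S \<and> card S \<le> n" using alg_independent_card_le[OF c S(1) B(3) B(2)] B(4) by simp
  moreover have "algebraic_over (adjoin (range c) S) x" for x
    by (rule algebraic_over_self) (simp_all add: S is_subfield_UNIV)
  ultimately show ?thesis
    using that[OF S] alg_independent_card_le[OF c B(1), of S] B(4) by auto
qed

section \<open>Bases over a subfield\<close>

text \<open>A maximal linearly independent set, given by Zorn's lemma, spans: any relation created
  by adding \<open>x\<close> must have a nonzero coefficient at \<open>x\<close> and can be solved
  for it.\<close>

lemma exists_basis_over:
  assumes F: "is_subfield F"
  shows "\<exists>A. basis_over F A"
proof -
  define ind where "ind A \<longleftrightarrow> (\<forall>S c. finite S \<and> S \<subseteq> A \<and> c ` S \<subseteq> F \<and> (\<Sum>a\<in>S. c a * a) = 0 \<longrightarrow> (\<forall>a\<in>S. c a = 0))"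
    for A :: "'a set"
  have "\<exists>M\<in>Collect ind. \<forall>X'\<in>Collect ind. M \<subseteq> X' \<longrightarrow> X' = M"
  proof (rule subset_Zorn_nonempty)
    show "Collect ind \<noteq> {}" by (auto simp: ind_def intro!: exI[of _ "{}"])
    fix \<C> assume C: "\<C> \<noteq> {}" "subset.chain (Collect ind) \<C>"
    have "ind (\<Union>\<C>)"
      unfolding ind_def
    proof (intro allI impI)
      fix S c assume a: "finite S \<and> S \<subseteq> \<Union>\<C> \<and> c ` S \<subseteq> F \<and> (\<Sum>a\<in>S. c a * a) = 0"
      then obtain A where A: "A \<in> \<C>" "S \<subseteq> A"
        using finite_subset_Union_chain[OF _ _ C] by metis
      then have "ind A" using C(2) by (auto simp: subset.chain_def)
      then show "\<forall>a\<in>S. c a = 0" using a A(2) unfolding ind_def by blast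
    qed
    then show "\<Union>\<C> \<in> Collect ind" by simp
  qed
  then obtain A where A: "ind A" "\<And>A'. ind A' \<Longrightarrow> A \<subseteq> A' \<Longrightarrow> A' = A" by auto
  have "\<exists>S c. finite S \<and> S \<subseteq> A \<and> c ` S \<subseteq> F \<and> x = (\<Sum>a\<in>S. c a * a)" for x
  proof (cases "x \<in> A")
    case True
    then show ?thesis
      by (intro exI[of _ "{x}"] exI[of _ "\<lambda>_. 1"]) (simp add: is_subfieldD[OF F])
  next
    case False
    then have "\<not> ind (insert x A)" using A(2)[of "insert x A"] by auto
    then obtain S c where S: "finite S" "S \<subseteq> insert x A" "c ` S \<subseteq> F" "(\<Sum>a\<in>S. c a * a) = 0"
      and nz: "\<exists>a\<in>S. c a \<noteq> 0"
      unfolding ind_def by blast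
    let ?T = "S - {x}"
    have "x \<in> S \<and> c x \<noteq> 0"
    proof (rule ccontr)
      assume n: "\<not> (x \<in> S \<and> c x \<noteq> 0)"
      have "(\<Sum>a\<in>?T. c a * a) = (\<Sum>a\<in>S. c a * a)"
        using n S(1) by (intro sum.mono_neutral_left) auto
      then have "finite ?T \<and> ?T \<subseteq> A \<and> c ` ?T \<subseteq> F \<and> (\<Sum>a\<in>?T. c a * a) = 0"
        using S by auto
      then have "\<forall>a\<in>?T. c a = 0"
        using A(1) unfolding ind_def by blast
      then show False using nz n by blast
    qed
    then have x: "x \<in> S" "c x \<noteq> 0" by auto
    have "c x * x + (\<Sum>a\<in>?T. c a * a) = 0"
      using S(4) sum.remove[OF S(1) x(1), of "\<lambda>a. c a * a"] by simp
    then have "c x * x = - (\<Sum>a\<in>?T. c a * a)" by (simp add: eq_neg_iff_add_eq_0)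
    then have "x = - inverse (c x) * (\<Sum>a\<in>?T. c a * a)"
      using x(2) by (simp add: field_simps)
    also have "\<dots> = (\<Sum>a\<in>?T. (- inverse (c x) * c a) * a)"
      by (simp add: sum_distrib_left mult.assoc)
    finally have "x = (\<Sum>a\<in>?T. (- inverse (c x) * c a) * a)" .
    moreover have "(\<lambda>a. - inverse (c x) * c a) ` ?T \<subseteq> F"
      using S(3) x(1) by (auto intro!: is_subfieldD[OF F])
    ultimately show ?thesis
      using S(1,2) by (intro exI[of _ ?T] exI[of _ "\<lambda>a. - inverse (c x) * c a"]) auto
  qed
  then show ?thesis using A(1) unfolding basis_over_def ind_def by blast
qed

section \<open>Finite groups of automorphisms\<close>

lemma field_homs_eqI:
  assumes "field_hom f" "field_hom g" "adjoin F S = UNIV"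
    and "\<And>x. x \<in> F \<Longrightarrow> f x = g x" "\<And>x. x \<in> S \<Longrightarrow> f x = g x"
  shows "f = g"
proof -
  have "adjoin F S \<subseteq> {x. f x = g x}"
    using assms by (intro adjoin_least is_subfield_equalizer) auto
  then show ?thesis using assms(3) by auto
qed

text \<open>An automorphism in \<open>G\<close> is determined by its values on \<open>T\<close>, and
  it sends each \<open>t\<close> to a root of a polynomial over the fixed field that depends only on
  \<open>t\<close>.\<close>

lemma finite_automorphisms:
  assumes G: "G \<subseteq> Aut F" and T: "finite T" "adjoin F T = UNIV"
    and alg: "\<And>x. algebraic_over (fixed_field G) x"
  shows "finite G"
proof -
  have "\<forall>x. \<exists>p. p \<noteq> 0 \<and> (\<forall>n. Polynomial.coeff p n \<in> fixed_field G) \<and> poly p x = 0"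
    using alg by (simp add: algebraic_over_def)
  then obtain p where p: "\<And>x. p x \<noteq> 0" "\<And>x n. Polynomial.coeff (p x) n \<in> fixed_field G" "\<And>x. poly (p x) x = 0"
    by metis
  have gh: "field_hom g" "\<And>x. x \<in> F \<Longrightarrow> g x = x" if "g \<in> G" for g using G that by (auto simp: Aut_def)
  have root: "poly (p x) (g x) = 0" if g: "g \<in> G" for g x
  proof -
    note u = field_hom_unital_hom[OF gh(1)[OF g]]
    have "map_poly g (p x) = p x"
      using p(2)[of x] g by (simp add: poly_eq_iff coeff_map_poly unital_homD(1)[OF u] fixed_field_def)
    then show ?thesis using poly_map_poly_hom[OF u, of "p x" x] p(3)[of x] unital_homD(1)[OF u] by simp
  qed
  \<comment> \<open>\<open>restrict\<close> forgets values outside \<open>T\<close>, which places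
    the maps in a finite product of root sets.\<close>
  have "inj_on (\<lambda>g. restrict g T) G"
  proof (rule inj_onI)
    fix g h assume gh': "g \<in> G" "h \<in> G" and e: "restrict g T = restrict h T"
    show "g = h"
    proof (rule field_homs_eqI[OF gh(1)[OF gh'(1)] gh(1)[OF gh'(2)] T(2)])
      show "g x = h x" if "x \<in> F" for x using gh(2)[OF gh'(1) that] gh(2)[OF gh'(2) that] by simp
      show "g x = h x" if "x \<in> T" for x using fun_cong[OF e, of x] that by simp
    qed
  qed
  moreover have "(\<lambda>g. restrict g T) ` G \<subseteq> (\<Pi>\<^sub>E t\<in>T. {y. poly (p t) y = 0})"
    using root by auto
  moreover have "finite (\<Pi>\<^sub>E t\<in>T. {y. poly (p t) y = 0})"
    using T(1) p(1) by (intro finite_PiE poly_roots_finite)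
  ultimately show ?thesis using finite_imageD finite_subset by metis
qed

text \<open>With the generators as coefficients of \<open>p \<in> M[Y]\<close>, the polynomial
  \<open>\<Prod>g\<in>G. (X - g p)\<close> in \<open>M[Y][X]\<close> has coefficients in \<open>M\<^sup>G[Y]\<close>, hence is fixed by \<open>\<tau>\<close>. Thus \<open>\<tau> p\<close> is one of its
  roots \<open>g p\<close>, and \<open>\<tau>\<close> agrees with \<open>g\<close> on all generators at once.\<close>

lemma artin_fixed_field:
  fixes G :: "('m::field \<Rightarrow> 'm) set"
  assumes G: "subgroup G (Aut_group F)" and fin: "finite G" and T: "finite T" "adjoin F T = UNIV"
  shows "Aut (fixed_field G) = G"
proof
  have GA: "G \<subseteq> Aut F" using subgroup.subset[OF G] by (simp add: Aut_group_def)
  show "G \<subseteq> Aut (fixed_field G)" using GA by (auto simp: Aut_def fixed_field_def)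
  have id: "id \<in> G" using subgroup.one_closed[OF G] by (simp add: Aut_group_def)
  have comp: "g \<circ> h \<in> G" if "g \<in> G" "h \<in> G" for g h
    using subgroup.m_closed[OF G that] by (simp add: Aut_group_def)
  have u: "unital_hom g" if "g \<in> G" for g
    using GA that by (auto simp: Aut_def intro: field_hom_unital_hom)
  show "Aut (fixed_field G) \<subseteq> G"
  proof
    fix \<tau> assume \<tau>: "\<tau> \<in> Aut (fixed_field G)"
    then have \<tau>h: "field_hom \<tau>" by (simp add: Aut_def)
    note \<tau>u = field_hom_unital_hom[OF \<tau>h]
    obtain ts where ts: "set ts = T" using finite_list[OF T(1)] by auto
    define p where "p = Poly ts"
    define Q where "Q = (\<Prod>g\<in>G. [:- map_poly g p, 1:])"
    have mapQ: "map_poly (map_poly h) Q = (\<Prod>g\<in>G. [:- map_poly (h \<circ> g) p, 1:])"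
      if h: "unital_hom h" for h
    proof -
      note h1 = unital_hom_map_poly[OF h]
      note h2 = unital_hom_map_poly[OF h1]
      have "map_poly (map_poly h) [:- map_poly g p, 1:] = [:- map_poly (h \<circ> g) p, 1:]" if "g \<in> G" for g
        using u[OF that] h h1 by (simp add: map_poly_pCons unital_hom_uminus unital_homD map_poly_map_poly)
      then show ?thesis unfolding Q_def by (simp add: unital_hom_prod[OF h2])
    qed
    have fixQ: "map_poly (map_poly h) Q = Q" if h: "h \<in> G" for h
    proof -
      have "inj h" using GA h by (auto simp: Aut_def bij_is_inj)
      \<comment> \<open>Left multiplication by \<open>h\<close> is injective on the finite set
        \<open>G\<close>, so it permutes the factors of \<open>Q\<close>.\<close>
      then have "inj_on ((\<circ>) h) G" by (auto simp: inj_on_def fun_eq_iff)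
      then have "(\<circ>) h ` G = G" using comp[OF h] fin by (intro endo_inj_surj) auto
      then have "(\<Prod>g\<in>G. [:- map_poly (h \<circ> g) p, 1:]) = Q"
        using prod.reindex[OF \<open>inj_on ((\<circ>) h) G\<close>, of "\<lambda>g. [:- map_poly g p, 1:]"]
        by (simp add: Q_def)
      then show ?thesis using mapQ[OF u[OF h]] by simp
    qed
    have c: "Polynomial.coeff (Polynomial.coeff Q n) k \<in> fixed_field G" for n k
      unfolding fixed_field_def
    proof (intro CollectI ballI)
      fix h assume h: "h \<in> G"
      note h0 = unital_homD(1)[OF u[OF h]]
      have "Polynomial.coeff (Polynomial.coeff (map_poly (map_poly h) Q) n) k = h (Polynomial.coeff (Polynomial.coeff Q n) k)"
        by (simp add: coeff_map_poly h0)
      then show "h (Polynomial.coeff (Polynomial.coeff Q n) k) = Polynomial.coeff (Polynomial.coeff Q n) k"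
        by (simp add: fixQ[OF h])
    qed
    have "map_poly (map_poly \<tau>) Q = Q"
      using c \<tau> by (simp add: poly_eq_iff coeff_map_poly unital_homD(1)[OF \<tau>u] Aut_def)
    moreover have "poly Q p = 0"
      unfolding Q_def poly_prod using id fin by (auto simp: map_poly_id intro!: bexI[of _ id])
    ultimately have "poly Q (map_poly \<tau> p) = 0"
      using poly_map_poly_hom[OF unital_hom_map_poly[OF \<tau>u], of Q p] by simp
    \<comment> \<open>M[Y] is an integral domain, so some factor vanishes.\<close>
    then obtain g where g: "g \<in> G" "map_poly \<tau> p = map_poly g p"
      unfolding Q_def poly_prod using fin by auto
    have gA: "g \<in> Aut F" using GA g(1) by auto
    have "\<tau> t = g t" if t: "t \<in> T" for t
    proof -
      obtain k where k: "k < length ts" "t = ts ! k" using t ts by (metis in_set_conv_nth)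
      have "Polynomial.coeff (map_poly \<tau> p) k = Polynomial.coeff (map_poly g p) k" by (simp add: g(2))
      then show ?thesis
        \<comment> \<open>\<open>Poly\<close> strips trailing zeros, but \<open>nth_default\<close>
          restores them, so coefficient \<open>k\<close> is \<open>ts ! k\<close> in every
          case.\<close>
        using k by (simp add: coeff_map_poly unital_homD(1)[OF \<tau>u] unital_homD(1)[OF u[OF g(1)]] p_def nth_default_def)
    qed
    \<comment> \<open>\<open>F\<close> lies in the fixed field of \<open>G\<close>, so
      \<open>\<tau>\<close> and \<open>g\<close> are both the identity on it.\<close>
    moreover have "\<tau> x = g x" if "x \<in> F" for x
      using that GA gA \<tau> by (auto simp: Aut_def fixed_field_def subset_iff)
    ultimately have "\<tau> = g"
      using gA by (intro field_homs_eqI[OF \<tau>h _ T(2)]) (auto simp: Aut_def)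
    then show "\<tau> \<in> G" using g(1) by simp
  qed
qed

section \<open>Transport along an isomorphism\<close>

lemma Aut_conjugate:
  assumes \<phi>: "field_hom \<phi>" "bij \<phi>" and \<sigma>: "\<sigma> \<in> Aut F"
  shows "\<phi> \<circ> \<sigma> \<circ> inv_into UNIV \<phi> \<in> Aut (\<phi> ` F)"
  using assms field_hom_inv[OF \<phi>]
  by (auto simp: Aut_def bij_is_inj intro!: field_hom_comp bij_comp bij_imp_bij_inv)

lemma subgroup_Aut_mono:
  assumes "F \<subseteq> E"
  shows "subgroup (Aut E) (Aut_group F)"
proof -
  interpret E: group "Aut_group E" by (rule group_Aut_group)
  interpret group "Aut_group F" by (rule group_Aut_group)
  have m: "\<sigma> \<circ> \<tau> \<in> Aut E" if "\<sigma> \<in> Aut E" "\<tau> \<in> Aut E" for \<sigma> \<tau>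
    using E.m_closed[of \<sigma> \<tau>] that by (simp add: Aut_group_def)
  have i: "inv\<^bsub>Aut_group F\<^esub> \<sigma> = inv_into UNIV \<sigma>" if "\<sigma> \<in> Aut F" for \<sigma>
    by (rule inv_equality)
      (use that Aut_inv[OF that] in \<open>auto simp: Aut_group_def Aut_def bij_is_inj\<close>)
  have s: "Aut E \<subseteq> Aut F" using assms by (auto simp: Aut_def)
  show ?thesis
  proof (rule subgroupI)
    show "Aut E \<subseteq> carrier (Aut_group F)" using s by (simp add: Aut_group_def)
    show "Aut E \<noteq> {}" using E.one_closed by (auto simp: Aut_group_def)
    show "inv\<^bsub>Aut_group F\<^esub> \<sigma> \<in> Aut E" if "\<sigma> \<in> Aut E" for \<sigma>
      using i[of \<sigma>] Aut_inv[OF that] that s by auto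
    show "\<sigma> \<otimes>\<^bsub>Aut_group F\<^esub> \<tau> \<in> Aut E" if "\<sigma> \<in> Aut E" "\<tau> \<in> Aut E" for \<sigma> \<tau>
      using m[OF that] by (simp add: Aut_group_def)
  qed
qed

lemma fixed_field_conjugate:
  assumes "bij \<phi>"
  shows "fixed_field ((\<lambda>\<sigma>. \<phi> \<circ> \<sigma> \<circ> inv_into UNIV \<phi>) ` H) = \<phi> ` fixed_field H"
proof -
  have 1: "inv_into UNIV \<phi> (\<phi> x) = x" for x using assms by (simp add: bij_is_inj)
  have 2: "\<phi> (inv_into UNIV \<phi> y) = y" for y using assms by (simp add: bij_is_surj surj_f_inv_f)
  show ?thesis
  proof (intro Set.set_eqI iffI)
    fix y assume "y \<in> fixed_field ((\<lambda>\<sigma>. \<phi> \<circ> \<sigma> \<circ> inv_into UNIV \<phi>) ` H)"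
    then have "inv_into UNIV \<phi> y \<in> fixed_field H"
      unfolding fixed_field_def by simp (metis 1)
    then show "y \<in> \<phi> ` fixed_field H" using 2 by (metis imageI)
  next
    fix y assume "y \<in> \<phi> ` fixed_field H"
    then show "y \<in> fixed_field ((\<lambda>\<sigma>. \<phi> \<circ> \<sigma> \<circ> inv_into UNIV \<phi>) ` H)"
      by (auto simp: fixed_field_def 1)
  qed
qed

section \<open>The two directions of the equivalence\<close>

lemma noether_solution_imp_nice_basis:
  fixes i :: "'k::field \<Rightarrow> 'l::field" and j :: "'k \<Rightarrow> 'm::field"
  assumes i: "field_hom i" and j: "field_hom j"
    and T: "finite T" "adjoin (range j) T = UNIV"
    and \<phi>: "field_hom \<phi>" "bij \<phi>" "\<And>k. \<phi> (i k) = j k"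
    and N: "noether_solution (range j) G"
  shows "\<exists>\<Delta> A. nice_basis (range i) \<Delta> A \<and> galois_over (adjoin (range i) \<Delta>) \<and>
       spatially_isomorphic i j (Aut (adjoin (range i) \<Delta>)) G"
proof -
  have G: "subgroup G (Aut_group (range j))" and alg: "\<And>x. algebraic_over (fixed_field G) x"
    using N by (auto simp: noether_solution_def)
  obtain S where S: "alg_independent (range j) S" "fixed_field G = adjoin (range j) S"
    using N by (auto simp: noether_solution_def purely_transcendental_def)
  have "G \<subseteq> Aut (range j)" using subgroup.subset[OF G] by (simp add: Aut_group_def)
  then have "finite G" by (rule finite_automorphisms[OF _ T alg])
  then have AG: "Aut (fixed_field G) = G" by (rule artin_fixed_field[OF G _ T])
  define \<theta> where "\<theta> = inv_into UNIV \<phi>"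
  have \<theta>: "field_hom \<theta>" unfolding \<theta>_def by (rule field_hom_inv[OF \<phi>(1,2)])
  have \<theta>\<phi>: "\<theta> (\<phi> x) = x" for x using \<phi>(2) by (simp add: \<theta>_def bij_is_inj)
  have \<phi>\<theta>: "\<phi> (\<theta> y) = y" for y using \<phi>(2) by (simp add: \<theta>_def bij_is_surj surj_f_inv_f)
  have "\<theta> (j k) = i k" for k by (metis \<phi>(3) \<theta>\<phi>)
  then have \<theta>j: "\<theta> ` range j = range i" by (simp add: image_image)
  have \<theta>b: "bij \<theta>" using \<phi>(2) by (simp add: \<theta>_def bij_imp_bij_inv)
  have inv\<theta>: "inv_into UNIV \<theta> = \<phi>" using \<phi>(2) by (simp add: \<theta>_def inv_inv_eq)
  define F where "F = adjoin (range i) (\<theta> ` S)"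
  have F: "F = \<theta> ` fixed_field G"
    by (simp add: F_def S(2) image_adjoin[OF \<theta>] \<theta>j)
  have \<phi>F: "\<phi> ` F = fixed_field G" by (simp add: F image_image \<phi>\<theta>)
  let ?c = "\<lambda>\<sigma>. \<phi> \<circ> \<sigma> \<circ> \<theta>"
  have c1: "?c \<sigma> \<in> G" if "\<sigma> \<in> Aut F" for \<sigma>
    using Aut_conjugate[OF \<phi>(1,2) that] by (simp add: \<phi>F AG \<theta>_def)
  have c2: "\<theta> \<circ> g \<circ> \<phi> \<in> Aut F" if "g \<in> G" for g
    using Aut_conjugate[OF \<theta> \<theta>b, of g "fixed_field G"] that by (simp add: F AG inv\<theta>)
  have cc: "?c (\<theta> \<circ> g \<circ> \<phi>) = g" for g by (simp add: fun_eq_iff \<phi>\<theta>)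
  have cG: "?c ` Aut F = G"
  proof
    show "?c ` Aut F \<subseteq> G" using c1 by blast
    show "G \<subseteq> ?c ` Aut F"
    proof
      fix g assume "g \<in> G"
      then show "g \<in> ?c ` Aut F" using imageI[OF c2, of g ?c] by (simp only: cc)
    qed
  qed
  have Fi: "range i \<subseteq> F" unfolding F_def by (rule adjoin_upper)
  obtain A where A: "basis_over F A"
    using exists_basis_over[of F] is_subfield_adjoin unfolding F_def by blast
  have "algebraic_over F x" for x
    using algebraic_over_image[OF \<theta> alg, of "\<phi> x"] by (simp add: F \<theta>\<phi>)
  moreover have "alg_independent (range i) (\<theta> ` S)"
    using alg_independent_image[OF j \<theta> S(1)] by (simp add: \<theta>j)
  ultimately have nb: "nice_basis (range i) (\<theta> ` S) A"
    using A by (simp add: nice_basis_def transcendence_base_def F_def)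
  \<comment> \<open>Both sides are the fixed field of \<open>G\<close>: the left because the
    conjugates of \<open>Aut F\<close> are exactly \<open>G\<close>, the right by the choice of
    \<open>F\<close>.\<close>
  have "\<phi> ` fixed_field (Aut F) = \<phi> ` F"
    using fixed_field_conjugate[OF \<phi>(2), of "Aut F"] cG \<phi>F by (simp add: \<theta>_def)
  then have gal: "galois_over F"
    unfolding galois_over_def using inj_image_eq_iff[OF field_hom_inj[OF \<phi>(1)]] by blast
  have inj: "inj_on ?c (Aut F)"
    by (rule inj_on_inverseI[where g="\<lambda>g. \<theta> \<circ> g \<circ> \<phi>"]) (simp add: fun_eq_iff \<theta>\<phi>)
  have "?c \<in> iso ((Aut_group (range i))\<lparr>carrier := Aut F\<rparr>) ((Aut_group (range j))\<lparr>carrier := G\<rparr>)"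
    unfolding iso_def hom_def bij_betw_def
    using inj cG c1 by (auto simp: Aut_group_def fun_eq_iff \<theta>\<phi>)
  \<comment> \<open>The clause on fixed points is the injectivity of \<open>\<phi>\<close>.\<close>
  moreover have "\<sigma> x = the_inv \<phi> (?c \<sigma> (\<phi> x)) \<and> (\<sigma> x = x \<longleftrightarrow> ?c \<sigma> (\<phi> x) = \<phi> x)" for \<sigma> x
    using the_inv_f_f[OF field_hom_inj[OF \<phi>(1)]] inj_eq[OF field_hom_inj[OF \<phi>(1)]] by (simp add: \<theta>\<phi>)
  ultimately have "spatially_isomorphic i j (Aut F) G"
    unfolding spatially_isomorphic_def
    using subgroup_Aut_mono[OF Fi] G \<phi> by (intro conjI exI[of _ ?c] exI[of _ \<phi>]) blast+
  then show ?thesis using nb gal unfolding F_def by blast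
qed

text \<open>Compatibility forces \<open>\<psi> g\<close> to be the conjugate of \<open>g\<close> by
  \<open>\<phi>\<close>, so \<open>G\<close> is a full conjugate of Aut(L/K(\<Delta>)). With the
  Galois condition its fixed field is the image of K(\<Delta>), generated by the independent image
  of \<Delta>.\<close>

lemma nice_basis_imp_noether_solution:
  fixes i :: "'k::field \<Rightarrow> 'l::field" and j :: "'k \<Rightarrow> 'm::field"
  assumes i: "field_hom i" and nb: "nice_basis (range i) \<Delta> A"
    and gal: "galois_over (adjoin (range i) \<Delta>)"
    and sp: "spatially_isomorphic i j (Aut (adjoin (range i) \<Delta>)) G"
  shows "noether_solution (range j) G"
proof -
  define F where "F = adjoin (range i) \<Delta>"
  obtain \<psi> \<phi> where G: "subgroup G (Aut_group (range j))"
    and \<psi>: "\<psi> \<in> iso ((Aut_group (range i))\<lparr>carrier := Aut F\<rparr>) ((Aut_group (range j))\<lparr>carrier := G\<rparr>)"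
    and \<phi>: "field_hom \<phi>" "bij \<phi>" "\<And>k. \<phi> (i k) = j k"
    and sp': "\<And>g x. g \<in> Aut F \<Longrightarrow> g x = the_inv \<phi> (\<psi> g (\<phi> x))"
    using sp unfolding spatially_isomorphic_def F_def by blast
  have \<phi>j: "\<phi> ` range i = range j" using \<phi>(3) by (simp add: image_image)
  have \<psi>eq: "\<psi> g = \<phi> \<circ> g \<circ> inv_into UNIV \<phi>" if g: "g \<in> Aut F" for g
  proof
    fix y
    have "\<phi> (g (inv_into UNIV \<phi> y)) = \<phi> (the_inv \<phi> (\<psi> g y))"
      using sp'[OF g, of "inv_into UNIV \<phi> y"] \<phi>(2) by (simp add: bij_is_surj surj_f_inv_f)
    also have "\<dots> = \<psi> g y"
      using \<phi>(2) by (intro f_the_inv_into_f) (auto simp: bij_def)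
    finally show "\<psi> g y = (\<phi> \<circ> g \<circ> inv_into UNIV \<phi>) y" by simp
  qed
  have "\<psi> ` Aut F = G" using \<psi> by (auto simp: iso_def bij_betw_def)
  then have "G = (\<lambda>g. \<phi> \<circ> g \<circ> inv_into UNIV \<phi>) ` Aut F" using \<psi>eq by (metis (no_types, lifting) image_cong)
  then have "fixed_field G = \<phi> ` fixed_field (Aut F)"
    using fixed_field_conjugate[OF \<phi>(2)] by metis
  then have fG: "fixed_field G = \<phi> ` F" using gal by (simp add: galois_over_def F_def)
  have \<Delta>: "alg_independent (range i) \<Delta>" "\<And>x. algebraic_over F x"
    using nb by (auto simp: nice_basis_def transcendence_base_def F_def)
  have "fixed_field G = adjoin (range j) (\<phi> ` \<Delta>)"
    by (simp add: fG F_def image_adjoin[OF \<phi>(1)] \<phi>j)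
  moreover have "alg_independent (range j) (\<phi> ` \<Delta>)"
    using alg_independent_image[OF i \<phi>(1) \<Delta>(1)] by (simp add: \<phi>j)
  moreover have "algebraic_over (fixed_field G) y" for y
  proof -
    have "\<phi> (inv_into UNIV \<phi> y) = y" using \<phi>(2) by (simp add: bij_is_surj surj_f_inv_f)
    then show ?thesis
      using algebraic_over_image[OF \<phi>(1) \<Delta>(2), of "inv_into UNIV \<phi> y"] by (simp add: fG)
  qed
  ultimately show ?thesis
    using G unfolding noether_solution_def purely_transcendental_def by blast
qed

theorem theorem8p21:
  fixes i :: "'k::field \<Rightarrow> 'l::field" and j :: "'k \<Rightarrow> 'm::field"
    and n :: nat and G :: "('m \<Rightarrow> 'm) set"
  assumes "field_hom i" and "field_hom j"
    and "purely_transcendental (range i) (UNIV :: 'l set)"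
    and "purely_transcendental (range j) (UNIV :: 'm set)"
    and "has_finite_trdeg (range i) (UNIV :: 'l set) n"
    and "has_finite_trdeg (range j) (UNIV :: 'm set) n"
    and "subgroup G (Aut_group (range j))"
  shows "noether_solution (range j) G \<longleftrightarrow>
    (\<exists>\<Delta> A. nice_basis (range i) \<Delta> A \<and>
       galois_over (adjoin (range i) \<Delta>) \<and>
       spatially_isomorphic i j (Aut (adjoin (range i) \<Delta>)) G)"
proof
  assume N: "noether_solution (range j) G"
  obtain S where S: "alg_independent (range i) S" "adjoin (range i) S = UNIV" "finite S" "card S = n"
    using purely_transcendental_trdeg_generators[OF assms(1,3,5)] .
  obtain T where T: "alg_independent (range j) T" "adjoin (range j) T = UNIV" "finite T" "card T = n"
    using purely_transcendental_trdeg_generators[OF assms(2,4,6)] .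
  obtain h where "bij_betw h S T"
    using finite_same_card_bij[OF S(3) T(3)] S(4) T(4) by auto
  then obtain \<phi> where \<phi>: "field_hom \<phi>" "bij \<phi>" "\<And>k. \<phi> (i k) = j k"
    using purely_transcendental_iso[OF assms(1,2) S(1,2) T(1,2)] by metis
  show "\<exists>\<Delta> A. nice_basis (range i) \<Delta> A \<and> galois_over (adjoin (range i) \<Delta>) \<and>
       spatially_isomorphic i j (Aut (adjoin (range i) \<Delta>)) G"
    by (rule noether_solution_imp_nice_basis[OF assms(1,2) T(3,2) \<phi> N])
next
  assume "\<exists>\<Delta> A. nice_basis (range i) \<Delta> A \<and> galois_over (adjoin (range i) \<Delta>) \<and>
       spatially_isomorphic i j (Aut (adjoin (range i) \<Delta>)) G"
  then show "noether_solution (range j) G"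
    using nice_basis_imp_noether_solution[OF assms(1)] by blast
qed

end
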